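(* Let $(V,E,\geq)$ be a properly ordered Bratteli diagram with infinite path space $X_{(V,E)}$ (so that $X_{(V,E)}$ is a Cantor set), and suppose that $(V,E)$ is of finite rank. Then the associated Bratteli-Vershik system $(X_{(V,E)},T_{(V,E)})$ is either (conjugate to) an odometer system or an expansive system.
   Context: **Bratteli diagrams.** A Bratteli diagram $(V,E)$ consists of a vertex set $V=\bigsqcup_{n\ge 0}V_n$ and an edge set $E=\bigsqcup_{n\ge 1}E_n$, where the $V_n$ and $E_n$ are finite disjoint nonempty sets and $V_0=\{v_0\}$ is a single point, together with source and range maps $s:E_n\to V_{n-1}$, $r:E_n\to V_n$ such that $s^{-1}(v)\neq\varnothing$ for all $v\in V$ and $r^{-1}(v)\neq\varnothing$ for all $v\in V\setminus V_0$. Multiple edges are allowed. For $k<l$, $E_{k+1}\circ\cdots\circ E_l$ denotes the set of paths $(e_{k+1},\dots,e_l)$ with $e_i\in E_i$ and $r(e_i)=s(e_{i+1})$; the source of such a path is $s(e_{k+1})$ and its range is $r(e_l)$. Given $0=m_0<m_1<m_2<\cdots$, the telescoping of $(V,E)$ to $\{m_n\}$ is the Bratteli diagram with vertex sets $V'_n=V_{m_n}$ and edge sets $E'_n=E_{m_{n-1}+1}\circ\cdots\circ E_{m_n}$. The diagram is *simple* if it has a telescoping in which, for each $n\ge1$, every vertex of level $n-1$ is connected by at least one edge to every vertex of level $n$. It is of *finite rank* if there is $L<\infty$ with $|V_n|\le L$ for all $n$. **Path space.** $X_{(V,E)}=\{(e_1,e_2,\dots): e_i\in E_i,\ r(e_i)=s(e_{i+1})\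 \forall i\ge 1\}$, with the relative topology from the product topology on $\prod_n E_n$ (each $E_n$ discrete). It is compact, metrizable and totally disconnected. The case where $X_{(V,E)}$ is finite is disregarded; for simple $(V,E)$ with $X_{(V,E)}$ infinite, it is a Cantor set. **Ordered diagrams.** An ordered Bratteli diagram $(V,E,\geq)$ is a Bratteli diagram with a partial order on $E$ such that two edges are comparable iff they have the same range; thus each $r^{-1}(v)$, $v\in V\setminus V_0$, is linearly ordered. $E_{\min}$ and $E_{\max}$ are the sets of minimal and maximal edges. It is *properly ordered* if $(V,E)$ is simple and there is a unique path $x_{\min}\in X_{(V,E)}$ all of whose edges are in $E_{\min}$ and a unique path $x_{\max}\in X_{(V,E)}$ all of whose edges are in $E_{\max}$. **Bratteli-Vershik system.** For $(V,E,\geq)$ properly ordered, $T_{(V,E)}:X_{(V,E)}\to X_{(V,E)}$ is defined by $T_{(V,E)}x_{\max}=x_{\min}$ and, for $x=(e_1,e_2,\dots)\ne x_{\max}$, by $T_{(V,E)}x=(f_1,\dots,f_k,e_{k+1},e_{k+2},\dots)$, where $k$ is the smallest index with $e_k\notin E_{\max}$, $f_k$ is the successor of $e_k$ in $r^{-1}(r(e_k))$, and $(f_1,\dots,f_{k-1})$ is the unique path from $v_0$ to $s(f_k)$ consisting of minimal edges. $T_{(V,E)}$ is a minimal homeomorphism. **Dynamics.** Two systems $(X,T)$, $(Y,S)$ (compact metric spaces with homeomorphisms) are *conjugate* if there is a homeomorphism $\pi:X\to Y$ with $\pi T=S\pi$. $(X,T)$ is *expansive* if there is $\delta>0$ such that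 $\sup_{n\in\mathbb Z}d(T^nx,T^ny)>\delta$ whenever $x\ne y$, where $d$ is a metric giving the topology of $X$ (the property does not depend on $d$). An *odometer* is the system $x\mapsto x+\hat 1$ on the $\mathfrak a$-adic group $G_{\mathfrak a}=\prod_{i\ge1}\{0,1,\dots,\tfrac{p_i}{p_{i-1}}-1\}$ (addition with carry to the right, $\hat 1=(1,0,0,\dots)$), where $p_0=1$ and each $p_i/p_{i-1}$ is an integer $\ge 2$; equivalently, translation by $1$ on the inverse limit $\varprojlim \mathbb Z/p_i\mathbb Z$. A system is called an odometer system if it is conjugate to such a system. *)

theory Defs
  imports "HOL-Analysis.Analysis"
begin

section \<open>Bratteli diagrams\<close>

text \<open>Edge levels are indexed from 1 on: \<open>Edg B 0\<close> is never used.\<close>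

record ('v, 'e) bratteli_data =
  Vtx :: "nat \<Rightarrow> 'v set"
  Edg :: "nat \<Rightarrow> 'e set"
  src :: "'e \<Rightarrow> 'v"
  rng :: "'e \<Rightarrow> 'v"

definition bratteli_diagram :: "('v, 'e) bratteli_data \<Rightarrow> bool" where
  "bratteli_diagram B \<longleftrightarrow>
     (\<forall>n. finite (Vtx B n) \<and> Vtx B n \<noteq> {}) \<and>
     (\<forall>n\<ge>1. finite (Edg B n) \<and> Edg B n \<noteq> {}) \<and>
     disjoint_family (Vtx B) \<and>
     disjoint_family_on (Edg B) {1..} \<and>
     (\<exists>v0. Vtx B 0 = {v0}) \<and>
     (\<forall>n\<ge>1. \<forall>e\<in>Edg B n. src B e \<in> Vtx B (n - 1) \<and> rng B e \<in> Vtx B n) \<and>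
     (\<forall>n. \<forall>v\<in>Vtx B n. \<exists>e\<in>Edg B (Suc n). src B e = v) \<and>
     (\<forall>n\<ge>1. \<forall>v\<in>Vtx B n. \<exists>e\<in>Edg B n. rng B e = v)"

text \<open>\<open>finite_paths B k l\<close> is the set of paths $(e_{k+1},\dots,e_l)$, so that the list
  element \<open>p ! i\<close> is the edge $e_{k+1+i}$; for \<open>k = l\<close> it consists of the empty path only.\<close>

definition finite_paths :: "('v, 'e) bratteli_data \<Rightarrow> nat \<Rightarrow> nat \<Rightarrow> 'e list set" where
  "finite_paths B k l = {p. length p = l - k \<and>
     (\<forall>i < l - k. p ! i \<in> Edg B (Suc (k + i))) \<and>
     (\<forall>i. Suc i < l - k \<longrightarrow> rng B (p ! i) = src B (p ! Suc i))}"

definition telescoping ::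
    "('v, 'e) bratteli_data \<Rightarrow> (nat \<Rightarrow> nat) \<Rightarrow> ('v, 'e list) bratteli_data" where
  "telescoping B m =
     \<lparr> Vtx = (\<lambda>n. Vtx B (m n)),
       Edg = (\<lambda>n. finite_paths B (m (n - 1)) (m n)),
       src = (\<lambda>p. src B (hd p)),
       rng = (\<lambda>p. rng B (last p)) \<rparr>"

definition fully_connected :: "('v, 'e) bratteli_data \<Rightarrow> bool" where
  "fully_connected B \<longleftrightarrow>
     (\<forall>n\<ge>1. \<forall>v\<in>Vtx B (n - 1). \<forall>w\<in>Vtx B n. \<exists>e\<in>Edg B n. src B e = v \<and> rng B e = w)"

definition simple_diagram :: "('v, 'e) bratteli_data \<Rightarrow> bool" where
  "simple_diagram B \<longleftrightarrow>
     (\<exists>m. m 0 = 0 \<and> strict_mono m \<and> fully_connected (telescoping B m))"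

definition finite_rank :: "('v, 'e) bratteli_data \<Rightarrow> bool" where
  "finite_rank B \<longleftrightarrow> (\<exists>L. \<forall>n. card (Vtx B n) \<le> L)"


section \<open>Path space\<close>

text \<open>An infinite path is a function on the index set \<open>{1..}\<close>, extended by \<open>undefined\<close>
  at index 0 as in the library's products \<open>PiE\<close>.\<close>

definition path_space :: "('v, 'e) bratteli_data \<Rightarrow> (nat \<Rightarrow> 'e) set" where
  "path_space B = {x \<in> Pi\<^sub>E {1..} (Edg B). \<forall>i\<ge>1. rng B (x i) = src B (x (Suc i))}"

definition path_topology :: "('v, 'e) bratteli_data \<Rightarrow> (nat \<Rightarrow> 'e) topology" where
  "path_topology B =
     subtopology (product_topology (\<lambda>i. discrete_topology (Edg B i)) {1..}) (path_space B)"


section \<open>Ordered diagrams and the Vershik map\<close>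

definition edges :: "('v, 'e) bratteli_data \<Rightarrow> 'e set" where
  "edges B = (\<Union>n\<in>{1..}. Edg B n)"

text \<open>The order is given as a relation, with \<open>(e, f) \<in> R\<close> meaning that \<open>e\<close> is below or
  equal to \<open>f\<close>.\<close>

definition ordered_diagram :: "('v, 'e) bratteli_data \<Rightarrow> 'e rel \<Rightarrow> bool" where
  "ordered_diagram B R \<longleftrightarrow> bratteli_diagram B \<and> partial_order_on (edges B) R \<and>
     (\<forall>e\<in>edges B. \<forall>f\<in>edges B. (e, f) \<in> R \<or> (f, e) \<in> R \<longleftrightarrow> rng B e = rng B f)"

definition min_edges :: "('v, 'e) bratteli_data \<Rightarrow> 'e rel \<Rightarrow> 'e set" where
  "min_edges B R = {e \<in> edges B. \<forall>f\<in>edges B. (f, e) \<in> R \<longrightarrow> f = e}"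

definition max_edges :: "('v, 'e) bratteli_data \<Rightarrow> 'e rel \<Rightarrow> 'e set" where
  "max_edges B R = {e \<in> edges B. \<forall>f\<in>edges B. (e, f) \<in> R \<longrightarrow> f = e}"

definition properly_ordered :: "('v, 'e) bratteli_data \<Rightarrow> 'e rel \<Rightarrow> bool" where
  "properly_ordered B R \<longleftrightarrow> ordered_diagram B R \<and> simple_diagram B \<and>
     (\<exists>!x. x \<in> path_space B \<and> (\<forall>i\<ge>1. x i \<in> min_edges B R)) \<and>
     (\<exists>!x. x \<in> path_space B \<and> (\<forall>i\<ge>1. x i \<in> max_edges B R))"

definition x_min :: "('v, 'e) bratteli_data \<Rightarrow> 'e rel \<Rightarrow> nat \<Rightarrow> 'e" where
  "x_min B R = (THE x. x \<in> path_space B \<and> (\<forall>i\<ge>1. x i \<in> min_edges B R))"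

definition x_max :: "('v, 'e) bratteli_data \<Rightarrow> 'e rel \<Rightarrow> nat \<Rightarrow> 'e" where
  "x_max B R = (THE x. x \<in> path_space B \<and> (\<forall>i\<ge>1. x i \<in> max_edges B R))"

definition edge_succ :: "('v, 'e) bratteli_data \<Rightarrow> 'e rel \<Rightarrow> 'e \<Rightarrow> 'e" where
  "edge_succ B R e = (THE f. f \<in> edges B \<and> (e, f) \<in> R \<and> f \<noteq> e \<and>
     (\<forall>g\<in>edges B. (e, g) \<in> R \<and> g \<noteq> e \<longrightarrow> (f, g) \<in> R))"

text \<open>The path $(f_1,\dots,f_{k-1})$ of minimal edges that ends at the source of the edge \<open>f\<close>
  of level \<open>k\<close>. It starts at $v_0$ automatically, as $V_0 = \{v_0\}$.\<close>

definition min_path_to_edge ::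
    "('v, 'e) bratteli_data \<Rightarrow> 'e rel \<Rightarrow> nat \<Rightarrow> 'e \<Rightarrow> 'e list" where
  "min_path_to_edge B R k f = (THE p. p \<in> finite_paths B 0 (k - 1) \<and>
     set p \<subseteq> min_edges B R \<and> (p \<noteq> [] \<longrightarrow> rng B (last p) = src B f))"

definition vershik_map ::
    "('v, 'e) bratteli_data \<Rightarrow> 'e rel \<Rightarrow> (nat \<Rightarrow> 'e) \<Rightarrow> (nat \<Rightarrow> 'e)" where
  "vershik_map B R x =
     (if x = x_max B R then x_min B R
      else
        let k = (LEAST k. 1 \<le> k \<and> x k \<notin> max_edges B R);
            f = edge_succ B R (x k);
            p = min_path_to_edge B R k f
        in (\<lambda>i\<in>{1..}. if i < k then p ! (i - 1) else if i = k then f else x i))"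


section \<open>Topological dynamics\<close>

definition dynamical_system :: "'a topology \<Rightarrow> ('a \<Rightarrow> 'a) \<Rightarrow> bool" where
  "dynamical_system X T \<longleftrightarrow> compact_space X \<and> metrizable_space X \<and> homeomorphic_map X X T"

definition conjugate_systems ::
    "'a topology \<Rightarrow> ('a \<Rightarrow> 'a) \<Rightarrow> 'b topology \<Rightarrow> ('b \<Rightarrow> 'b) \<Rightarrow> bool" where
  "conjugate_systems X T Y S \<longleftrightarrow>
     (\<exists>\<pi>. homeomorphic_map X Y \<pi> \<and> (\<forall>x\<in>topspace X. \<pi> (T x) = S (\<pi> x)))"

definition int_iterate :: "'a set \<Rightarrow> ('a \<Rightarrow> 'a) \<Rightarrow> int \<Rightarrow> 'a \<Rightarrow> 'a" where
  "int_iterate A T n =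
     (if n \<ge> 0 then T ^^ nat n else inv_into A T ^^ nat (- n))"

text \<open>The supremum is taken in the extended reals, so that no boundedness has to be known.\<close>

definition expansive_system :: "'a topology \<Rightarrow> ('a \<Rightarrow> 'a) \<Rightarrow> bool" where
  "expansive_system X T \<longleftrightarrow> dynamical_system X T \<and>
     (\<exists>d. Metric_space (topspace X) d \<and> Metric_space.mtopology (topspace X) d = X \<and>
       (\<exists>\<delta>>0. \<forall>x\<in>topspace X. \<forall>y\<in>topspace X. x \<noteq> y \<longrightarrow>
          (SUP n. ereal (d (int_iterate (topspace X) T n x) (int_iterate (topspace X) T n y)))
            > ereal \<delta>))"


section \<open>Odometers\<close>

definition odometer_base :: "(nat \<Rightarrow> nat) \<Rightarrow> bool" where
  "odometer_base p \<longleftrightarrow> p 0 = 1 \<and> (\<forall>i\<ge>1. p (i - 1) dvd p i \<and> p i div p (i - 1) \<ge> 2)"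

definition odometer_topology :: "(nat \<Rightarrow> nat) \<Rightarrow> (nat \<Rightarrow> nat) topology" where
  "odometer_topology p =
     product_topology (\<lambda>i. discrete_topology {..<p i div p (i - 1)}) {1..}"

text \<open>\<open>odometer_carry p x y i\<close> is the carry into coordinate \<open>i\<close>; there is none into the first
  coordinate, which has index 1.\<close>

fun odometer_carry :: "(nat \<Rightarrow> nat) \<Rightarrow> (nat \<Rightarrow> nat) \<Rightarrow> (nat \<Rightarrow> nat) \<Rightarrow> nat \<Rightarrow> nat" where
  "odometer_carry p x y 0 = 0"
| "odometer_carry p x y (Suc 0) = 0"
| "odometer_carry p x y (Suc (Suc i)) =
     (x (Suc i) + y (Suc i) + odometer_carry p x y (Suc i)) div (p (Suc i) div p i)"

definition odometer_add ::
    "(nat \<Rightarrow> nat) \<Rightarrow> (nat \<Rightarrow> nat) \<Rightarrow> (nat \<Rightarrow> nat) \<Rightarrow> nat \<Rightarrow> nat" where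
  "odometer_add p x y =
     (\<lambda>i\<in>{1..}. (x i + y i + odometer_carry p x y i) mod (p i div p (i - 1)))"

definition odometer_one :: "nat \<Rightarrow> nat" where
  "odometer_one = (\<lambda>i\<in>{1..}. if i = 1 then 1 else 0)"

definition odometer_system :: "'a topology \<Rightarrow> ('a \<Rightarrow> 'a) \<Rightarrow> bool" where
  "odometer_system X T \<longleftrightarrow>
     (\<exists>p. odometer_base p \<and>
        conjugate_systems X T (odometer_topology p) (\<lambda>x. odometer_add p x odometer_one))"

end

theory Submission
  imports Defs "HOL-Library.Stream"
begin

text \<open>
  Fix a level \<open>n\<close> and record along the orbit of a path \<open>x\<close> the initial segments of length
  \<open>n\<close>. This gives a bi-infinite sequence, the \<open>n\<close>-th row of \<open>x\<close>. The \<open>n\<close>-th row is cut into words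
  at the times when the initial segment consists of minimal edges, and the word between two
  consecutive cuts is determined by the vertex of level \<open>n\<close> through which the path runs. Under finite
  rank, all rows are therefore concatenations of words from sets \<open>W\<^sub>n\<close> of at most \<open>L\<close> elements, with
  \<open>L\<close> independent of \<open>n\<close>. Moreover row \<open>i\<close> is obtained from row \<open>j \<ge> i\<close> by truncating each letter.

  The combinatorial core is a defect theorem for bi-infinite words (\<open>unique_cutting\<close>): if a
  non-periodic sequence has two different factorizations over a finite set \<open>X\<close> of words, then \<open>X\<close> is
  contained in \<open>F\<^sup>*\<close> for a set \<open>F\<close> with fewer elements than \<open>X\<close>. It rests on \<open>first_factor_code\<close>:
  every finite set of words can be factored over an omega-code all of whose elements occur as first
  factors, so that two words of \<open>X\<close> with the same first factor already save one element.

  Let \<open>r(i, j)\<close> be the least size of a set of words that generates the truncations of \<open>W\<^sub>j\<close> to level \<open>i\<close>.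
  It is at most \<open>L\<close> and increases with \<open>i\<close>. If \<open>i < j < k\<close> and \<open>r(i, k) = r(j, k)\<close>, take a generating
  set \<open>G\<close> of that size at level \<open>j\<close>: truncation is injective on \<open>G\<close> and the truncated set cannot be
  generated by fewer words, so by the defect theorem a non-periodic row \<open>i\<close> determines the cuts into
  truncated words of \<open>G\<close>, hence row \<open>j\<close>. As \<open>r\<close> takes at most \<open>L + 1\<close> values, some row determines
  all later ones as soon as the rows of high level are not periodic
  (\<open>some_row_determines_all\<close>), and a row that determines the path means expansiveness.

  Otherwise every level has a periodic row. All orbits are dense by simplicity of the diagram, so one
  periodic row at level \<open>n\<close> makes all \<open>n\<close>-th rows periodic with the same period. The periods grow
  without bound along a divisibility chain, and the phases of a path modulo these periods, written in
  mixed radix, conjugate the system to an odometer.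
\<close>

section \<open>Omega-codes and the defect of a set of words\<close>

coinductive omega_power :: "'a list set \<Rightarrow> 'a stream \<Rightarrow> bool" for X where
  "\<lbrakk>x \<in> X; x \<noteq> []; omega_power X s\<rbrakk> \<Longrightarrow> omega_power X (x @- s)"

text \<open>Uniqueness of the first factor gives uniqueness of the whole infinite factorization by
  iteration, and first factors are all that gets compared below.\<close>
definition omega_code :: "'a list set \<Rightarrow> bool" where
  "omega_code F \<longleftrightarrow> [] \<notin> F \<and>
     (\<forall>f\<in>F. \<forall>g\<in>F. \<forall>s t. omega_power F s \<longrightarrow> omega_power F t \<longrightarrow> f @- s = g @- t \<longrightarrow> f = g)"

lemma omega_power_concat:
  assumes "set ws \<subseteq> F" "[] \<notin> F" "omega_power F s"
  shows "omega_power F (concat ws @- s)"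
  using assms(1)
proof (induction ws)
  case Nil
  then show ?case using assms by simp
next
  case (Cons w ws)
  then have "omega_power F (w @- (concat ws @- s))"
    using assms(2) omega_power.intros[of w F "concat ws @- s"] by auto
  then show ?case by simp
qed

lemma omega_power_refine:
  assumes X: "\<And>x. x \<in> X \<Longrightarrow> \<exists>ws. set ws \<subseteq> F \<and> x = concat ws"
    and F: "[] \<notin> F" and s: "omega_power X s"
  shows "omega_power F s"
proof -
  have "\<exists>ws s'. s = concat ws @- s' \<and> set ws \<subseteq> F \<and> omega_power X s'"
    by (rule exI[of _ "[]"], rule exI[of _ s]) (use s in auto)
  then show ?thesis
  proof (coinduction arbitrary: s)
    case omega_power
    then obtain ws s' where ws: "s = concat ws @- s'" "set ws \<subseteq> F" "omega_power X s'"
      by blast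
    have "\<exists>w us t. s = concat (w # us) @- t \<and> set (w # us) \<subseteq> F \<and> omega_power X t"
    proof (cases ws)
      case (Cons w us)
      then show ?thesis using ws by blast
    next
      case Nil
      from ws(3) obtain x t where x: "s' = x @- t" "x \<in> X" "x \<noteq> []" "omega_power X t"
        by (cases rule: omega_power.cases) auto
      from X[OF x(2)] obtain vs where vs: "set vs \<subseteq> F" "x = concat vs" by blast
      with x(3) obtain v vs' where "vs = v # vs'" by (cases vs) auto
      with vs x Nil ws(1) have "s = concat (v # vs') @- t" "set (v # vs') \<subseteq> F" by auto
      with x(4) show ?thesis by blast
    qed
    then obtain w us t where *: "s = concat (w # us) @- t" "set (w # us) \<subseteq> F" "omega_power X t"
      by blast
    then have "s = w @- (concat us @- t)" "w \<in> F" "w \<noteq> []"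
      using F by auto
    moreover have "\<exists>ws s'. concat us @- t = concat ws @- s' \<and> set ws \<subseteq> F \<and> omega_power X s'"
      using * by (intro exI[of _ us] exI[of _ t]) auto
    ultimately show ?case by blast
  qed
qed

lemma omega_power_mono: "omega_power F s \<Longrightarrow> F \<subseteq> G \<Longrightarrow> [] \<notin> G \<Longrightarrow> omega_power G s"
  by (rule omega_power_refine[of F]) (auto intro!: exI[of _ "[_]"])

lemma omega_code_subset: "omega_code G \<Longrightarrow> F \<subseteq> G \<Longrightarrow> omega_code F"
  unfolding omega_code_def by (metis omega_power_mono subsetD)

lemma omega_code_singletons: "omega_code {[a] |a. True}"
  unfolding omega_code_def by auto

text \<open>If \<open>f\<close> is never the first factor of a word, each block of copies of \<open>f\<close> can be merged into the
  factor before it. Repeating this makes every remaining factor a first factor of some word.\<close>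
function absorb :: "'a list \<Rightarrow> 'a list list \<Rightarrow> 'a list list" where
  "absorb f [] = []"
| "absorb f (w # ws) = (w @ concat (takeWhile ((=) f) ws)) # absorb f (dropWhile ((=) f) ws)"
  by pat_completeness auto
termination
proof (relation "Wellfounded.measure (length \<circ> snd)")
  fix f :: "'a list" and w ws
  show "((f, dropWhile ((=) f) ws), f, w # ws) \<in> Wellfounded.measure (length \<circ> snd)"
    using length_dropWhile_le[of "(=) f" ws] by simp
qed simp

definition absorbed :: "'a list \<Rightarrow> 'a list set \<Rightarrow> 'a list set" where
  "absorbed f F = {w @ concat (replicate k f) |w k. w \<in> F \<and> w \<noteq> f}"

lemma takeWhile_eq_replicate: "\<exists>k. takeWhile ((=) f) ws = replicate k f"
  by (rule exI, rule replicate_eqI[OF refl]) (auto dest: set_takeWhileD)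

lemma concat_absorb: "concat (absorb f ws) = concat ws"
proof (induction f ws rule: absorb.induct)
  case (2 f w ws)
  have "concat (takeWhile ((=) f) ws) @ concat (dropWhile ((=) f) ws) = concat ws"
    by (simp flip: concat_append)
  with 2 show ?case by simp
qed simp

lemma length_absorb: "length (absorb f ws) \<le> length ws"
proof (induction f ws rule: absorb.induct)
  case (2 f w ws)
  then show ?case using length_dropWhile_le[of "(=) f" ws] by simp
qed simp

lemma length_absorb_less:
  "f \<in> set ws \<Longrightarrow> hd ws \<noteq> f \<Longrightarrow> length (absorb f ws) < length ws"
proof (induction f ws rule: absorb.induct)
  case (2 f w ws)
  show ?case
  proof (cases "takeWhile ((=) f) ws = []")
    case True
    then have "hd ws \<noteq> f" "dropWhile ((=) f) ws = ws" using 2(2,3)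
      by (cases ws; auto)+
    then show ?thesis using 2 by auto
  next
    case False
    have "length (absorb f (dropWhile ((=) f) ws)) \<le> length (dropWhile ((=) f) ws)"
      by (rule length_absorb)
    moreover have "length ws = length (takeWhile ((=) f) ws) + length (dropWhile ((=) f) ws)"
      by (metis length_append takeWhile_dropWhile_id)
    moreover have "0 < length (takeWhile ((=) f) ws)" unfolding length_greater_0_conv using False by blast
    ultimately show ?thesis unfolding absorb.simps list.size by linarith
  qed
qed simp

lemma set_absorb:
  "set ws \<subseteq> F \<Longrightarrow> ws \<noteq> [] \<Longrightarrow> hd ws \<noteq> f \<Longrightarrow> set (absorb f ws) \<subseteq> absorbed f F"
proof (induction f ws rule: absorb.induct)
  case (2 f w ws)
  let ?d = "dropWhile ((=) f) ws"
  have "w @ concat (takeWhile ((=) f) ws) \<in> absorbed f F"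
  proof -
    obtain k where "takeWhile ((=) f) ws = replicate k f"
      using takeWhile_eq_replicate[of f ws] by (elim exE)
    moreover have "w \<in> F" "w \<noteq> f" using 2(2,4) by auto
    ultimately show ?thesis unfolding absorbed_def by auto
  qed
  moreover have "set (absorb f ?d) \<subseteq> absorbed f F"
  proof (cases "?d = []")
    case True
    then show ?thesis by (simp del: dropWhile_eq_Nil_conv)
  next
    case False
    moreover have "hd ?d \<noteq> f" using False hd_dropWhile[of "(=) f" ws] by auto
    moreover have "set ?d \<subseteq> F" using 2(2) set_dropWhileD by fastforce
    ultimately show ?thesis using 2(1) by simp
  qed
  ultimately show ?case by simp
qed simp

text \<open>An infinite product over the absorbed set never begins with \<open>f\<close>. In \<open>w f\<^sup>k\<close> followed by such a
  product, the code property of \<open>F\<close> therefore recovers \<open>w\<close>, and then the exponent \<open>k\<close>. The absorbed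
  set is infinite, which is harmless because only finitely many of its elements are used.\<close>
lemma omega_code_absorbed:
  assumes F: "omega_code F" and f: "f \<in> F"
  shows "omega_code (absorbed f F)"
proof -
  let ?F = "absorbed f F"
  have ne: "[] \<notin> F" using F by (simp add: omega_code_def)
  have ne': "[] \<notin> ?F" using ne by (auto simp: absorbed_def)
  have coarse: "omega_power F s" if "omega_power ?F s" for s
  proof (rule omega_power_refine[OF _ ne that])
    fix x assume "x \<in> ?F"
    then obtain w k where "x = w @ concat (replicate k f)" "w \<in> F" by (auto simp: absorbed_def)
    then show "\<exists>ws. set ws \<subseteq> F \<and> x = concat ws"
      using f by (intro exI[of _ "w # replicate k f"]) auto
  qed
  have uniq: "v = w" if "v \<in> F" "w \<in> F" "omega_power F s" "omega_power F t" "v @- s = w @- t" for v w s t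
    using F that unfolding omega_code_def by blast
  have rep: "omega_power F (concat (replicate k f) @- s)" if "omega_power F s" for k s
    using f by (intro omega_power_concat[OF _ ne that]) auto
  have no_f: "s \<noteq> f @- t" if "omega_power ?F s" "omega_power F t" for s t
  proof
    assume eq: "s = f @- t"
    from that(1) obtain x s' where x: "s = x @- s'" "x \<in> ?F" "omega_power ?F s'"
      by (cases rule: omega_power.cases) auto
    then obtain w k where w: "x = w @ concat (replicate k f)" "w \<in> F" "w \<noteq> f"
      by (auto simp: absorbed_def)
    have "w @- (concat (replicate k f) @- s') = f @- t"
      using eq x w by simp
    with uniq[OF w(2) f rep[OF coarse[OF x(3)]] that(2)] w(3) show False by blast
  qed
  have cancel: "k = l" if "k \<le> l" "omega_power ?F s" "omega_power ?F t"
      "concat (replicate k f) @- s = concat (replicate l f) @- t" for k l s t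
  proof (rule ccontr)
    assume "k \<noteq> l"
    with that(1) have "k < l" by simp
    then obtain m where "l = k + Suc m" using less_imp_Suc_add by fastforce
    then have "concat (replicate k f) @- s
        = concat (replicate k f) @- (f @- (concat (replicate m f) @- t))"
      using that(4) \<open>l = k + Suc m\<close>
      by (simp only: replicate_add replicate_Suc concat_append concat.simps shift_append)
    then have "s = f @- (concat (replicate m f) @- t)"
      by (metis shift_left_inj)
    with no_f[OF that(2) rep[OF coarse[OF that(3)]]] show False by blast
  qed
  show ?thesis
    unfolding omega_code_def
  proof (intro conjI ne' ballI allI impI)
    fix x y s t
    assume *: "x \<in> ?F" "y \<in> ?F" "omega_power ?F s" "omega_power ?F t" "x @- s = y @- t"
    then obtain v k w l where x: "x = v @ concat (replicate k f)" "v \<in> F"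
      and y: "y = w @ concat (replicate l f)" "w \<in> F" by (auto simp: absorbed_def)
    have eq: "v @- (concat (replicate k f) @- s) = w @- (concat (replicate l f) @- t)"
      using * x y by simp
    then have "v = w"
      using uniq[OF x(2) y(2) rep[OF coarse] rep[OF coarse]] * by blast
    with eq have "concat (replicate k f) @- s = concat (replicate l f) @- t"
      by (metis shift_left_inj)
    then have "k = l" using cancel[of k l s t] cancel[of l k t s] * by (metis nle_le)
    with \<open>v = w\<close> x y show "x = y" by simp
  qed
qed

text \<open>Among all factorizations of the words of \<open>X\<close> over omega-codes, one with the least total number
  of factors has the required form: a factor \<open>f\<close> that is nowhere first could be absorbed, which
  would shorten the factorization. Factoring into single letters is the starting point.\<close>
lemma first_factor_code:
  assumes "finite X" "[] \<notin> X"
  shows "\<exists>F h. omega_code F \<and> h ` X = F \<and> (\<forall>x\<in>X. \<exists>ws. set ws \<subseteq> F \<and> x = h x @ concat ws)"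
proof -
  have "\<exists>F h. omega_code F \<and> h ` X = F \<and> (\<forall>x\<in>X. \<exists>ws. set ws \<subseteq> F \<and> x = h x @ concat ws)"
    if "omega_code F" "\<forall>x\<in>X. set (g x) \<subseteq> F \<and> concat (g x) = x" for F g
    using that
  proof (induction "\<Sum>x\<in>X. length (g x)" arbitrary: F g rule: less_induct)
    case less
    let ?G = "\<Union>x\<in>X. set (g x)"
    have gne: "g x \<noteq> []" if "x \<in> X" for x using less(3) that assms(2) by (metis concat.simps(1))
    have G: "omega_code ?G" by (rule omega_code_subset[OF less(2)]) (use less(3) in auto)
    show ?case
    proof (cases "?G \<subseteq> (\<lambda>x. hd (g x)) ` X")
      case True
      moreover have "(\<lambda>x. hd (g x)) ` X \<subseteq> ?G" using gne by (auto intro!: bexI)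
      ultimately have hdG: "(\<lambda>x. hd (g x)) ` X = ?G" by (rule antisym[rotated])
      have "\<exists>ws. set ws \<subseteq> ?G \<and> x = hd (g x) @ concat ws" if "x \<in> X" for x
      proof (intro exI[of _ "tl (g x)"] conjI)
        show "set (tl (g x)) \<subseteq> ?G" using that gne[OF that] by (auto dest: list.set_sel(2))
        show "x = hd (g x) @ concat (tl (g x))"
          using that less(3) gne[OF that] by (metis concat.simps(2) list.collapse)
      qed
      then show ?thesis using G hdG by (intro exI[of _ ?G] exI[of _ "\<lambda>x. hd (g x)"]) auto
    next
      case False
      then obtain f x0 where f: "x0 \<in> X" "f \<in> set (g x0)" "\<And>x. x \<in> X \<Longrightarrow> hd (g x) \<noteq> f"
        by blast
      let ?g = "\<lambda>x. absorb f (g x)"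
      have "(\<Sum>x\<in>X. length (?g x)) < (\<Sum>x\<in>X. length (g x))"
        using assms(1) f length_absorb length_absorb_less
        by (intro sum_strict_mono_ex1) blast+
      moreover have "omega_code (absorbed f ?G)" using G f(1,2) by (intro omega_code_absorbed) auto
      moreover have "\<forall>x\<in>X. set (?g x) \<subseteq> absorbed f ?G \<and> concat (?g x) = x"
      proof (intro ballI conjI)
        fix x assume x: "x \<in> X"
        then have "set (g x) \<subseteq> ?G" by blast
        from set_absorb[OF this gne[OF x] f(3)[OF x]] show "set (?g x) \<subseteq> absorbed f ?G" .
        show "concat (?g x) = x" using less(3) x by (simp add: concat_absorb)
      qed
      ultimately show ?thesis by (rule less(1))
    qed
  qed
  from this[OF omega_code_singletons, of "map (\<lambda>a. [a])"] show ?thesis by auto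
qed

definition generates :: "'a list set \<Rightarrow> 'a list set \<Rightarrow> bool" where
  "generates F X \<longleftrightarrow> finite F \<and> [] \<notin> F \<and> (\<forall>x\<in>X. \<exists>ws. set ws \<subseteq> F \<and> x = concat ws)"

text \<open>In the terminology of combinatorics on words, the combinatorial rank of \<open>X\<close> is less than its
  cardinality.\<close>
definition defective :: "'a list set \<Rightarrow> bool" where
  "defective X \<longleftrightarrow> (\<exists>F. generates F X \<and> card F < card X)"

text \<open>Add the overhang \<open>u\<close> to \<open>X\<close> and take a code \<open>F\<close> of first factors for \<open>insert u X\<close>. Both relations
  force the first factor of \<open>u\<close> to be that of \<open>x\<close> and that of \<open>x'\<close>. So the first factors of \<open>X\<close> alone
  exhaust \<open>F\<close>, and two words of \<open>X\<close> share one. Allowing \<open>u\<close> outside \<open>X\<close>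
  covers two factorizations without a common cut.\<close>
lemma defect:
  assumes X: "finite X" "[] \<notin> X" and x: "x \<in> X" "x' \<in> X" "x \<noteq> x'" and u: "u \<noteq> []"
    and om: "omega_power X s" "omega_power X t" "omega_power X s'" "omega_power X t'"
    and eq: "u @- s = x @- t" "u @- s' = x' @- t'"
  shows "defective X"
proof -
  obtain F h where F: "omega_code F" "h ` insert u X = F"
    and h: "\<And>y. y \<in> insert u X \<Longrightarrow> \<exists>ws. set ws \<subseteq> F \<and> y = h y @ concat ws"
    using first_factor_code[of "insert u X"] X u by auto
  have ne: "[] \<notin> F" using F(1) by (simp add: omega_code_def)
  have fac: "\<exists>ws. set ws \<subseteq> F \<and> y = concat ws" if "y \<in> X" for y
    using h[of y] that F(2) by (metis concat.simps(2) image_insert insertI2 insert_subset list.simps(15) image_eqI)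
  have omF: "omega_power F r" if "omega_power X r" for r
    by (rule omega_power_refine[OF fac ne that])
  have same: "h y = h z" if "y \<in> insert u X" "z \<in> insert u X" "omega_power X r" "omega_power X q"
      "y @- r = z @- q" for y z r q
  proof -
    note yz = that
    obtain ws vs where ws: "set ws \<subseteq> F" "y = h y @ concat ws" and vs: "set vs \<subseteq> F" "z = h z @ concat vs"
      using h[OF yz(1)] h[OF yz(2)] by blast
    have "h y @- (concat ws @- r) = h z @- (concat vs @- q)"
      using that(5) ws(2) vs(2) by (metis shift_append)
    moreover have "h y \<in> F" "h z \<in> F" using F(2) that by auto
    ultimately show ?thesis using F(1) omega_power_concat[OF ws(1) ne omF[OF that(3)]]
        omega_power_concat[OF vs(1) ne omF[OF that(4)]] unfolding omega_code_def by blast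
  qed
  have "h u = h x" "h u = h x'" using same x om eq by blast+
  then have "F = h ` X" "h x = h x'" using F(2) x by auto
  then have "card F < card X"
    using card_image_le[OF X(1), of h] x inj_on_iff_eq_card[OF X(1), of h] unfolding inj_on_def
    by (metis le_neq_implies_less)
  then show ?thesis using \<open>F = h ` X\<close> X(1) ne fac unfolding defective_def generates_def
    by (intro exI[of _ F]) auto
qed

section \<open>Factorizations of bi-infinite sequences\<close>

definition segment :: "(int \<Rightarrow> 'a) \<Rightarrow> int \<Rightarrow> int \<Rightarrow> 'a list" where
  "segment y a b = map y [a..b - 1]"

definition consec :: "int set \<Rightarrow> int \<Rightarrow> int \<Rightarrow> bool" where
  "consec K a b \<longleftrightarrow> a \<in> K \<and> b \<in> K \<and> a < b \<and> (\<forall>k\<in>K. k \<le> a \<or> b \<le> k)"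

text \<open>A factorization of a bi-infinite sequence is represented by its set of cut positions: the words
  can be read off the sequence between consecutive cuts.\<close>
definition cutting :: "'a list set \<Rightarrow> (int \<Rightarrow> 'a) \<Rightarrow> int set \<Rightarrow> bool" where
  "cutting X y K \<longleftrightarrow> (\<forall>n. \<exists>k\<in>K. n < k) \<and> (\<forall>n. \<exists>k\<in>K. k < n) \<and>
     (\<forall>a b. consec K a b \<longrightarrow> segment y a b \<in> X)"

definition periodic :: "(int \<Rightarrow> 'a) \<Rightarrow> bool" where
  "periodic y \<longleftrightarrow> (\<exists>p>0. \<forall>k. y (k + p) = y k)"

definition stream_from :: "(int \<Rightarrow> 'a) \<Rightarrow> int \<Rightarrow> 'a stream" where
  "stream_from y c = smap (\<lambda>n. y (c + int n)) nats"

lemma length_segment [simp]: "length (segment y a b) = nat (b - a)"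
  by (simp add: segment_def)

lemma nth_segment: "i < nat (b - a) \<Longrightarrow> segment y a b ! i = y (a + int i)"
  by (simp add: segment_def)

lemma segment_eq_iff:
  assumes "a \<le> b" "a' \<le> b'"
  shows "segment y a b = segment z a' b' \<longleftrightarrow>
    b - a = b' - a' \<and> (\<forall>i. 0 \<le> i \<longrightarrow> i < b - a \<longrightarrow> y (a + i) = z (a' + i))"
proof
  assume eq: "segment y a b = segment z a' b'"
  then have "nat (b - a) = nat (b' - a')" using length_segment by metis
  then have len: "b - a = b' - a'" using assms by linarith
  moreover have "y (a + i) = z (a' + i)" if "0 \<le> i" "i < b - a" for i
  proof -
    have "nat i < nat (b - a)" "nat i < nat (b' - a')" using that len by auto
    then show ?thesis using nth_segment[of "nat i" b a y] nth_segment[of "nat i" b' a' z] eq that(1)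
      by simp
  qed
  ultimately show "b - a = b' - a' \<and> (\<forall>i. 0 \<le> i \<longrightarrow> i < b - a \<longrightarrow> y (a + i) = z (a' + i))" by blast
next
  assume "b - a = b' - a' \<and> (\<forall>i. 0 \<le> i \<longrightarrow> i < b - a \<longrightarrow> y (a + i) = z (a' + i))"
  then show "segment y a b = segment z a' b'"
    by (intro nth_equalityI) (auto simp: nth_segment)
qed

lemma stream_from_nth: "stream_from y c !! n = y (c + int n)"
  by (simp add: stream_from_def)

lemma segment_shift:
  assumes "a \<le> b"
  shows "segment y a b @- stream_from y b = stream_from y a"
proof -
  have "(segment y a b @- stream_from y b) !! n = stream_from y a !! n" for n
  proof (cases "n < nat (b - a)")
    case True
    then show ?thesis by (simp add: nth_segment stream_from_def)
  next
    case False
    then have "b + int (n - nat (b - a)) = a + int n" using assms by simp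
    then have "stream_from y b !! (n - nat (b - a)) = stream_from y a !! n"
      by (metis stream_from_nth)
    then show ?thesis using False by simp
  qed
  then show ?thesis by (metis stream_smap_nats stream.map_cong0 ext)
qed

lemma next_cut:
  assumes "\<And>n. \<exists>k\<in>K. n < (k::int)"
  obtains b where "b \<in> K" "a < b" "\<And>k. k \<in> K \<Longrightarrow> k \<le> a \<or> b \<le> k"
proof -
  obtain k0 where k0: "k0 \<in> K" "a < k0" using assms by blast
  define P where "P n \<longleftrightarrow> a + 1 + int n \<in> K" for n
  have "P (nat (k0 - a - 1))" using k0 by (simp add: P_def)
  then have L: "P (LEAST n. P n)" by (rule LeastI)
  have "k \<le> a \<or> a + 1 + int (LEAST n. P n) \<le> k" if "k \<in> K" for k
  proof (rule disjCI)
    assume *: "\<not> a + 1 + int (LEAST n. P n) \<le> k"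
    show "k \<le> a"
    proof (rule ccontr)
      assume "\<not> k \<le> a"
      then have "P (nat (k - a - 1))" using that by (simp add: P_def)
      then have "(LEAST n. P n) \<le> nat (k - a - 1)" by (rule Least_le)
      with * \<open>\<not> k \<le> a\<close> show False by linarith
    qed
  qed
  with L that[of "a + 1 + int (LEAST n. P n)"] show thesis by (auto simp: P_def)
qed

lemma previous_cut:
  assumes "\<And>n. \<exists>k\<in>K. (k::int) < n"
  obtains b where "b \<in> K" "b \<le> a" "\<And>k. k \<in> K \<Longrightarrow> k \<le> b \<or> a < k"
proof -
  have "\<exists>k\<in>uminus ` K. n < k" for n
  proof -
    obtain k where "k \<in> K" "k < - n" using assms by blast
    then show ?thesis by (intro bexI[of _ "- k"]) auto
  qed
  then obtain b where "b \<in> uminus ` K" "- a - 1 < b" "\<And>k. k \<in> uminus ` K \<Longrightarrow> k \<le> - a - 1 \<or> b \<le> k"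
    by (rule next_cut[where a = "- a - 1"]) blast
  then show thesis by (intro that[of "- b"]) (force+)
qed

lemma cutting_next:
  assumes "cutting X y K"
  obtains b where "b \<in> K" "a < b" "\<And>k. k \<in> K \<Longrightarrow> k \<le> a \<or> b \<le> k"
  using assms next_cut[of K a] unfolding cutting_def by blast

lemma cutting_previous:
  assumes "cutting X y K"
  obtains b where "b \<in> K" "b \<le> a" "\<And>k. k \<in> K \<Longrightarrow> k \<le> b \<or> a < k"
  using assms previous_cut[of K a] unfolding cutting_def by blast

lemma cutting_consec:
  assumes "cutting X y K" "a \<in> K"
  obtains b where "consec K a b" "segment y a b \<in> X"
  using cutting_next[OF assms(1), of a] assms unfolding cutting_def consec_def by metis

lemma omega_power_cutting:
  assumes "cutting X y K" "[] \<notin> X" "c \<in> K"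
  shows "omega_power X (stream_from y c)"
proof -
  have "\<exists>d\<in>K. stream_from y c = stream_from y d" using assms by blast
  then show ?thesis
  proof (coinduction arbitrary: c)
    case omega_power
    then obtain d where d: "d \<in> K" "stream_from y c = stream_from y d" by blast
    obtain b where b: "consec K d b" "segment y d b \<in> X" using cutting_consec[OF assms(1) d(1)] .
    have "d \<le> b" "b \<in> K" using b(1) by (auto simp: consec_def)
    then have "stream_from y c = segment y d b @- stream_from y b"
      using d segment_shift by metis
    moreover have "segment y d b \<noteq> []" using b(2) assms(2) by metis
    ultimately show ?case using b(2) \<open>b \<in> K\<close> by blast
  qed
qed

text \<open>Two different continuations of the same overhang \<open>u\<close> are exactly the two relations of
  \<open>defect\<close>: from a cut of \<open>K\<close>, the sequence can be read as a \<open>K\<close>-factorization, or as \<open>u\<close>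
  followed by a \<open>K'\<close>-factorization.\<close>
lemma overhang_determines_word:
  assumes X: "finite X" "[] \<notin> X" "\<not> defective X"
    and K: "cutting X y K" "cutting X y K'"
    and c: "consec K c d" "e \<in> K'" "c < e"
    and c': "consec K c' d'" "e' \<in> K'" "c' < e'"
    and eq: "segment y c e = segment y c' e'"
  shows "segment y c d = segment y c' d'"
proof (rule ccontr)
  assume neq: "segment y c d \<noteq> segment y c' d'"
  note om = omega_power_cutting[OF K(1) X(2)] omega_power_cutting[OF K(2) X(2)]
  have d: "d \<in> K" "c < d" "segment y c d \<in> X" "d' \<in> K" "c' < d'" "segment y c' d' \<in> X"
    using c c' K unfolding cutting_def consec_def by auto
  have ne: "segment y c e \<noteq> []" using c(3) by (simp flip: length_greater_0_conv)
  have "segment y c e @- stream_from y e = segment y c d @- stream_from y d"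
    using c d by (simp add: segment_shift)
  moreover have "segment y c e @- stream_from y e' = segment y c' d' @- stream_from y d'"
    unfolding eq using c' d by (simp add: segment_shift)
  ultimately have "defective X"
    using defect[OF X(1,2) d(3,6) neq ne] om(1)[OF d(1)] om(1)[OF d(4)] om(2)[OF c(2)] om(2)[OF c'(2)]
    by blast
  with X show False by blast
qed

text \<open>The merged cuts of two disjoint cuttings behave like the run of a deterministic automaton whose
  state is the overhang up to the next cut of the other cutting. The next word ends
  either before that cut, leaving a shorter overhang, or after it, in which case the
  two cuttings exchange their roles.\<close>
lemma overhang_determines_future:
  assumes X: "finite X" "[] \<notin> X" "\<not> defective X"
  shows "\<lbrakk>cutting X y K; cutting X y K'; K \<inter> K' = {};
    c \<in> K; e \<in> K'; c < e; \<forall>k\<in>K'. k \<le> c \<or> e \<le> k;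
    c' \<in> K; e' \<in> K'; c' < e'; \<forall>k\<in>K'. k \<le> c' \<or> e' \<le> k;
    segment y c e = segment y c' e'\<rbrakk> \<Longrightarrow> y (c + int t) = y (c' + int t)"
proof (induction t arbitrary: K K' c e c' e' rule: less_induct)
  case (less t)
  note pr = less.prems
  have e: "e - c = e' - c'" and ey: "\<And>i. 0 \<le> i \<Longrightarrow> i < e - c \<Longrightarrow> y (c + i) = y (c' + i)"
    using pr segment_eq_iff[of c e c' e' y y] by auto
  show ?case
  proof (cases "int t < e - c")
    case True
    then show ?thesis using ey[of "int t"] by simp
  next
    case t: False
    obtain d where d: "consec K c d" using cutting_consec[OF pr(1,4)] .
    obtain d' where d': "consec K c' d'" using cutting_consec[OF pr(1,8)] .
    have "segment y c d = segment y c' d'"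
      by (rule overhang_determines_word[OF X pr(1,2) d pr(5,6) d' pr(9,10,12)])
    then have dd: "d - c = d' - c'" and dy: "\<And>i. 0 \<le> i \<Longrightarrow> i < d - c \<Longrightarrow> y (c + i) = y (c' + i)"
      using d d' segment_eq_iff[of c d c' d' y y] by (auto simp: consec_def)
    have dK: "d \<in> K" "d' \<in> K" "c < d" "c' < d'" using d d' by (auto simp: consec_def)
    have "d \<noteq> e" using dK pr by blast
    then consider "d < e" | "e < d" by linarith
    then show ?thesis
    proof cases
      case 1
      have "segment y d e = segment y d' e'"
      proof (subst segment_eq_iff)
        show "e - d = e' - d' \<and> (\<forall>i. 0 \<le> i \<longrightarrow> i < e - d \<longrightarrow> y (d + i) = y (d' + i))"
        proof (intro conjI allI impI)
          fix i assume i: "0 \<le> i" "i < e - d"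
          have "c + (d - c + i) = d + i" "c' + (d - c + i) = d' + i" using dd by simp_all
          moreover have "0 \<le> d - c + i" "d - c + i < e - c" using i dK by simp_all
          ultimately show "y (d + i) = y (d' + i)" using ey by metis
        qed (use e dd in linarith)
      qed (use 1 e dd in auto)
      moreover have "t - nat (d - c) < t" using 1 t dK by linarith
      moreover have "\<forall>k\<in>K'. k \<le> d \<or> e \<le> k" "\<forall>k\<in>K'. k \<le> d' \<or> e' \<le> k" "d' < e'"
        using pr(7,11) dK 1 e dd by force+
      ultimately have "y (d + int (t - nat (d - c))) = y (d' + int (t - nat (d - c)))"
        using less.IH[of "t - nat (d - c)" K K' d e d' e'] pr dK 1 by blast
      moreover have "d + int (t - nat (d - c)) = c + int t" "d' + int (t - nat (d - c)) = c' + int t"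
        using 1 t dK dd by linarith+
      ultimately show ?thesis by metis
    next
      case 2
      have "segment y e d = segment y e' d'"
      proof (subst segment_eq_iff)
        show "d - e = d' - e' \<and> (\<forall>i. 0 \<le> i \<longrightarrow> i < d - e \<longrightarrow> y (e + i) = y (e' + i))"
        proof (intro conjI allI impI)
          fix i assume i: "0 \<le> i" "i < d - e"
          have "c + (e - c + i) = e + i" "c' + (e - c + i) = e' + i" using e by simp_all
          moreover have "0 \<le> e - c + i" "e - c + i < d - c" using i pr(6) by simp_all
          ultimately show "y (e + i) = y (e' + i)" using dy by metis
        qed (use e dd in linarith)
      qed (use 2 e dd in auto)
      moreover have "t - nat (e - c) < t" using t pr(6) by linarith
      moreover have "\<forall>k\<in>K. k \<le> e \<or> d \<le> k" "\<forall>k\<in>K. k \<le> e' \<or> d' \<le> k" "e' < d'"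
        using d d' pr(6,10) 2 e dd by (force simp: consec_def)+
      moreover have "K' \<inter> K = {}" using pr(3) by blast
      ultimately have "y (e + int (t - nat (e - c))) = y (e' + int (t - nat (e - c)))"
        using less.IH[of "t - nat (e - c)" K' K e d e' d'] pr dK 2 by blast
      moreover have "e + int (t - nat (e - c)) = c + int t" "e' + int (t - nat (e - c)) = c' + int t"
        using t pr(6) e by linarith+
      ultimately show ?thesis by metis
    qed
  qed
qed

lemma infinite_unbounded_below:
  fixes S :: "int set"
  assumes "infinite S" "\<And>s. s \<in> S \<Longrightarrow> s \<le> 0"
  shows "\<exists>s\<in>S. s < n"
proof (rule ccontr)
  assume "\<not> ?thesis"
  then have "S \<subseteq> {n..0}" using assms(2) by force
  with assms(1) show False using finite_subset by blast
qed

text \<open>Overhangs are suffixes of words of \<open>X\<close>, so there are finitely many, and one of them recurs at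
  positions tending to minus infinity. Two occurrences have the same future,
  which makes the sequence periodic to the right of the first one. The earlier occurrences carry the
  period to the left.\<close>
lemma disjoint_cuttings_periodic:
  assumes X: "finite X" "[] \<notin> X" "\<not> defective X"
    and K: "cutting X y K" "cutting X y K'" "K \<inter> K' = {}"
  shows "periodic y"
proof -
  have "\<exists>e. e \<in> K' \<and> c < e \<and> (\<forall>k\<in>K'. k \<le> c \<or> e \<le> k)" for c
    using cutting_next[OF K(2), of c] by metis
  then obtain e where e: "\<And>c. e c \<in> K'" "\<And>c. c < e c" "\<And>c. \<forall>k\<in>K'. k \<le> c \<or> e c \<le> k"
    by metis
  \<comment> \<open>e c is the first cut of K' after c, so this is the overhang at c\<close>
  define over where "over c = segment y c (e c)" for c
  define A where "A = {c \<in> K. c \<le> 0}"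
  have unb: "\<exists>s\<in>A. s < n" for n
  proof -
    obtain s where "s \<in> K" "s < min n 1" using K(1) unfolding cutting_def by blast
    then show ?thesis by (auto simp: A_def)
  qed
  have "infinite A"
  proof
    assume fin: "finite A"
    obtain s where "s \<in> A" "s < Min A" using unb by blast
    then show False using Min_le[OF fin] by force
  qed
  moreover have "over ` A \<subseteq> (\<Union>x\<in>X. (\<lambda>n. drop n x) ` {..length x})"
  proof
    fix w assume "w \<in> over ` A"
    then obtain c where w: "w = segment y c (e c)" by (auto simp: over_def)
    obtain p where p: "p \<in> K'" "p \<le> c" "\<And>k. k \<in> K' \<Longrightarrow> k \<le> p \<or> c < k"
      using cutting_previous[OF K(2), of c] by metis
    have "consec K' p (e c)" using p e unfolding consec_def by (metis linorder_not_le order_le_less_trans)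
    then have seg: "segment y p (e c) \<in> X" using K(2) by (simp add: cutting_def)
    have "w = drop (nat (c - p)) (segment y p (e c))" unfolding w
      using p(2) e(2)[of c] by (intro nth_equalityI) (auto simp: nth_segment algebra_simps)
    moreover have "nat (c - p) \<le> length (segment y p (e c))" using e(2)[of c] by simp
    ultimately show "w \<in> (\<Union>x\<in>X. (\<lambda>n. drop n x) ` {..length x})" using seg by blast
  qed
  then have "finite (over ` A)" by (rule finite_subset) (use X(1) in auto)
  ultimately obtain a where a: "a \<in> A" "infinite {b \<in> A. over b = over a}"
    using pigeonhole_infinite by blast
  define S where "S = {b \<in> A. over b = over a}"
  have S: "\<exists>s\<in>S. s < n" for n
  proof (rule infinite_unbounded_below)
    show "infinite S" unfolding S_def by (rule a(2))
  qed (simp add: S_def A_def)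
  have same: "y (s + int t) = y (a + int t)" if "s \<in> S" for s t
    by (rule overhang_determines_future[OF X K, of s "e s" a "e a"])
      (use that a e in \<open>auto simp: S_def A_def over_def\<close>)
  obtain s where s: "s \<in> S" "s < a" using S by blast
  have "y (k + (a - s)) = y k" for k
  proof -
    obtain m where m: "m \<in> S" "m < k" using S by blast
    have "y (k + (a - s)) = y (m + int (nat (k - m + (a - s))))" using m s by simp
    also have "\<dots> = y (s + int (nat (k - m + (a - s))))" using same m s by metis
    also have "\<dots> = y (a + int (nat (k - m)))" using m s by (simp add: algebra_simps)
    also have "\<dots> = y (m + int (nat (k - m)))" using same m by metis
    also have "\<dots> = y k" using m by simp
    finally show ?thesis .
  qed
  with s(2) show ?thesis unfolding periodic_def by (intro exI[of _ "a - s"]) auto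
qed

text \<open>At a common cut the next words must agree: otherwise one of them serves as the overhang in
  \<open>defect\<close>, where the first of the two relations is then trivial.\<close>
lemma common_cut_right:
  assumes X: "finite X" "[] \<notin> X" "\<not> defective X"
    and K: "cutting X y K" "cutting X y K'"
    and k: "k \<in> K"
  shows "c \<in> K \<Longrightarrow> c \<in> K' \<Longrightarrow> c \<le> k \<Longrightarrow> k \<in> K'"
proof (induction "nat (k - c)" arbitrary: c rule: less_induct)
  case less
  show ?case
  proof (cases "c = k")
    case False
    obtain d where d: "consec K c d" using cutting_consec[OF K(1) less(2)] .
    obtain d' where d': "consec K' c d'" using cutting_consec[OF K(2) less(3)] .
    have D: "d \<in> K" "c < d" "segment y c d \<in> X" "d' \<in> K'" "c < d'" "segment y c d' \<in> X" "d \<le> k"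
      using d d' K k less(4) False unfolding cutting_def consec_def by auto
    have "segment y c d = segment y c d'"
    proof (rule ccontr)
      assume neq: "segment y c d \<noteq> segment y c d'"
      have ne: "segment y c d \<noteq> []" using D(3) X by metis
      have eq: "segment y c d @- stream_from y d = segment y c d' @- stream_from y d'"
        using D by (simp add: segment_shift)
      show False
        using defect[OF X(1,2) D(3,6) neq ne _ _ _ _ refl eq] X(3)
          omega_power_cutting[OF K(1) X(2) D(1)] omega_power_cutting[OF K(2) X(2) D(4)] by blast
    qed
    then have "d = d'" using segment_eq_iff[of c d c d' y y] D by auto
    with D less(1)[of d] show ?thesis by auto
  qed (use less in auto)
qed

lemma defective_rev:
  assumes "defective (rev ` X)"
  shows "defective X"
proof -
  obtain F where F: "finite F" "[] \<notin> F" "card F < card (rev ` X)"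
    "\<And>x. x \<in> rev ` X \<Longrightarrow> \<exists>ws. set ws \<subseteq> F \<and> x = concat ws"
    using assms unfolding defective_def generates_def by auto
  have "\<exists>ws. set ws \<subseteq> rev ` F \<and> x = concat ws" if "x \<in> X" for x
  proof -
    have "\<exists>ws. set ws \<subseteq> F \<and> rev x = concat ws" using that by (intro F(4)) simp
    then obtain ws where ws: "set ws \<subseteq> F" "rev x = concat ws" by blast
    then have "x = rev (concat ws)" by (metis rev_rev_ident)
    then have "x = concat (map rev (rev ws))" by (simp add: rev_concat rev_map)
    then show ?thesis using ws(1) by (intro exI[of _ "map rev (rev ws)"]) auto
  qed
  moreover have "card (rev ` F) < card X"
    using F(3) by (simp add: card_image)
  ultimately show ?thesis using F(1,2) unfolding defective_def generates_def
    by (intro exI[of _ "rev ` F"]) auto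
qed

lemma cutting_rev:
  assumes "cutting X y K"
  shows "cutting (rev ` X) (\<lambda>k. y (- k - 1)) (uminus ` K)"
  unfolding cutting_def
proof (intro conjI allI impI)
  fix n
  obtain k where "k \<in> K" "k < - n" using assms unfolding cutting_def by blast
  then show "\<exists>k\<in>uminus ` K. n < k" by (intro bexI[of _ "- k"]) auto
next
  fix n
  obtain k where "k \<in> K" "- n < k" using assms unfolding cutting_def by blast
  then show "\<exists>k\<in>uminus ` K. k < n" by (intro bexI[of _ "- k"]) auto
next
  fix a b assume "consec (uminus ` K) a b"
  then have *: "consec K (- b) (- a)" "a < b" unfolding consec_def by force+
  then have "segment y (- b) (- a) \<in> X" using assms by (simp add: cutting_def)
  moreover have "segment (\<lambda>k. y (- k - 1)) a b = rev (segment y (- b) (- a))"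
  proof (intro nth_equalityI)
    fix i assume i: "i < length (segment (\<lambda>k. y (- k - 1)) a b)"
    then have "- b + int (nat (b - a) - Suc i) = - (a + int i) - 1" by auto
    then have "y (- b + int (nat (b - a) - Suc i)) = y (- (a + int i) - 1)" by (rule arg_cong)
    with i show "segment (\<lambda>k. y (- k - 1)) a b ! i = rev (segment y (- b) (- a)) ! i"
      by (simp add: nth_segment rev_nth)
  qed simp
  ultimately show "segment (\<lambda>k. y (- k - 1)) a b \<in> rev ` X" by simp
qed

text \<open>By non-periodicity the two cuttings meet. They agree to the right of a common cut, and, applying the
  same argument to the reversed sequence, to the left of it.\<close>
theorem unique_cutting:
  assumes X: "finite X" "[] \<notin> X" "\<not> defective X"
    and K: "cutting X y K" "cutting X y K'"
    and y: "\<not> periodic y"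
  shows "K = K'"
proof -
  obtain c where c: "c \<in> K" "c \<in> K'"
    using disjoint_cuttings_periodic[OF X K] y by blast
  have X': "finite (rev ` X)" "[] \<notin> rev ` X" "\<not> defective (rev ` X)"
    using X defective_rev by auto
  note K' = cutting_rev[OF K(1)] cutting_rev[OF K(2)]
  have "k \<in> K \<longleftrightarrow> k \<in> K'" for k
  proof (cases "c \<le> k")
    case True
    then show ?thesis
      using common_cut_right[OF X K _ c] common_cut_right[OF X K(2,1) _ c(2,1)] by blast
  next
    case False
    then have "- k \<in> uminus ` K \<longleftrightarrow> - k \<in> uminus ` K'"
      using common_cut_right[OF X' K', of "- k" "- c"]
        common_cut_right[OF X' K'(2,1), of "- k" "- c"] c by auto
    then show ?thesis by auto
  qed
  then show ?thesis by blast
qed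

lemma cuts_of_concat:
  assumes "[] \<notin> G"
  shows "set ws \<subseteq> G \<Longrightarrow> a \<le> b \<Longrightarrow> segment y a b = concat ws \<Longrightarrow>
    \<exists>P\<subseteq>{a..b}. a \<in> P \<and> b \<in> P \<and> (\<forall>c d. consec P c d \<longrightarrow> segment y c d \<in> G)"
proof (induction ws arbitrary: a)
  case Nil
  then have "nat (b - a) = 0" using length_segment[of y a b] by simp
  then have "a = b" using Nil(2) by simp
  then show ?case by (intro exI[of _ "{a}"]) (auto simp: consec_def)
next
  case (Cons w ws)
  define m where "m = a + int (length w)"
  have len: "nat (b - a) = length w + length (concat ws)"
    using length_segment[of y a b] unfolding Cons(4) by simp
  have wpos: "length w > 0" using Cons(2) assms by auto
  have m: "a < m" "m \<le> b" using len wpos Cons(3) unfolding m_def by linarith+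
  have "segment y a m = take (length w) (segment y a b)"
    using m by (intro nth_equalityI) (auto simp: nth_segment m_def)
  then have w: "segment y a m = w" using Cons(4) by simp
  have "segment y m b = drop (length w) (segment y a b)"
    using m by (intro nth_equalityI) (auto simp: nth_segment m_def algebra_simps)
  then have "segment y m b = concat ws" using Cons(4) by simp
  moreover have "set ws \<subseteq> G" using Cons(2) by simp
  ultimately have "\<exists>P\<subseteq>{m..b}. m \<in> P \<and> b \<in> P \<and> (\<forall>c d. consec P c d \<longrightarrow> segment y c d \<in> G)"
    using m(2) by (intro Cons.IH)
  then obtain P where P: "P \<subseteq> {m..b}" "m \<in> P" "b \<in> P"
      "\<And>c d. consec P c d \<Longrightarrow> segment y c d \<in> G"
    by blast
  have "segment y c d \<in> G" if "consec (insert a P) c d" for c d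
  proof (cases "c = a")
    case True
    then have "d = m" using that P m unfolding consec_def by force
    with True w Cons(2) show ?thesis by simp
  next
    case False
    then have "consec P c d" using that P(1) m unfolding consec_def by force
    then show ?thesis by (rule P)
  qed
  then show ?case using P m by (intro exI[of _ "insert a P"]) auto
qed

lemma cutting_refine:
  assumes K: "cutting X y K" and G: "[] \<notin> G"
    and X: "\<And>x. x \<in> X \<Longrightarrow> \<exists>ws. set ws \<subseteq> G \<and> x = concat ws"
  shows "\<exists>K'. cutting G y K'"
proof -
  have "\<exists>P. P \<subseteq> {a..b} \<and> a \<in> P \<and> b \<in> P \<and> (\<forall>c d. consec P c d \<longrightarrow> segment y c d \<in> G)"
    if "consec K a b" for a b
  proof -
    have "segment y a b \<in> X" "a \<le> b" using that K by (auto simp: cutting_def consec_def)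
    with X cuts_of_concat[OF G] show ?thesis by metis
  qed
  then obtain P where P: "\<And>a b. consec K a b \<Longrightarrow> P a b \<subseteq> {a..b} \<and> a \<in> P a b \<and> b \<in> P a b \<and>
      (\<forall>c d. consec (P a b) c d \<longrightarrow> segment y c d \<in> G)"
    by metis
  define K' where "K' = (\<Union>(a, b)\<in>{(a, b). consec K a b}. P a b)"
  have sub: "K \<subseteq> K'"
  proof
    fix a assume "a \<in> K"
    then obtain b where "consec K a b" using cutting_consec[OF K] by metis
    with P show "a \<in> K'" by (auto simp: K'_def)
  qed
  have block: "k \<in> P a b" if "consec K a b" "k \<in> K'" "a \<le> k" "k \<le> b" for a b k
  proof -
    note ak = that
    obtain a' b' where a': "consec K a' b'" "k \<in> P a' b'" using ak(2) by (auto simp: K'_def)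
    then have "a' \<le> k" "k \<le> b'" using P by fastforce+
    show ?thesis
    proof (cases "k = a \<or> k = b")
      case True
      then show ?thesis using P[OF that(1)] by auto
    next
      case False
      then have "a < k" "k < b" using that by auto
      then have "a' = a" "b' = b"
        using that(1) a'(1) \<open>a' \<le> k\<close> \<open>k \<le> b'\<close> unfolding consec_def by force+
      with a' show ?thesis by simp
    qed
  qed
  have "segment y c d \<in> G" if cd: "consec K' c d" for c d
  proof -
    obtain a where a: "a \<in> K" "a \<le> c" "\<And>k. k \<in> K \<Longrightarrow> k \<le> a \<or> c < k"
      using cutting_previous[OF K] by metis
    obtain b where b: "consec K a b" using cutting_consec[OF K a(1)] by metis
    have "c < b" "b \<in> K" using a b unfolding consec_def by force+
    then have "d \<le> b" using cd sub unfolding consec_def by force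
    have "c \<in> P a b" "d \<in> P a b"
      using block[OF b] cd a \<open>c < b\<close> \<open>d \<le> b\<close> unfolding consec_def by auto
    moreover have "P a b \<subseteq> K'" using b by (auto simp: K'_def)
    ultimately have "consec (P a b) c d" using cd unfolding consec_def by blast
    then show ?thesis using P[OF b] by blast
  qed
  then have "cutting G y K'" using K sub unfolding cutting_def by blast
  then show ?thesis by blast
qed

lemma cutting_map: "cutting X y K \<Longrightarrow> cutting (map f ` X) (f \<circ> y) K"
  unfolding cutting_def segment_def by (auto simp flip: map_map)

section \<open>Nested families of sequences over boundedly many words\<close>

text \<open>The combinatorial rank of a set of words.\<close>
definition word_rank :: "'a list set \<Rightarrow> nat" where
  "word_rank X = (LEAST n. \<exists>F. generates F X \<and> card F = n)"

lemma word_rank_le: "generates F X \<Longrightarrow> word_rank X \<le> card F"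
  unfolding word_rank_def by (rule Least_le) blast

lemma generates_self:
  assumes "finite X" "[] \<notin> X"
  shows "generates X X"
proof -
  have "\<exists>ws. set ws \<subseteq> X \<and> x = concat ws" if "x \<in> X" for x
    using that by (intro exI[of _ "[x]"]) simp
  then show ?thesis using assms by (simp add: generates_def)
qed

lemma word_rank_attained:
  assumes "finite X" "[] \<notin> X"
  obtains F where "generates F X" "card F = word_rank X"
proof -
  have "\<exists>n F. generates F X \<and> card F = n" using generates_self[OF assms] by blast
  then have "\<exists>F. generates F X \<and> card F = word_rank X"
    unfolding word_rank_def by (rule LeastI_ex)
  with that show thesis by blast
qed

lemma generates_map:
  assumes "generates F X"
  shows "generates (map f ` F) (map f ` X)"
  unfolding generates_def
proof (intro conjI ballI)
  fix y assume "y \<in> map f ` X"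
  then obtain x where x: "x \<in> X" "y = map f x" by blast
  then obtain ws where "set ws \<subseteq> F" "x = concat ws" using assms by (auto simp: generates_def)
  then show "\<exists>ws. set ws \<subseteq> map f ` F \<and> y = concat ws"
    using x by (intro exI[of _ "map (map f) ws"]) (auto simp: map_concat)
qed (use assms in \<open>auto simp: generates_def\<close>)

lemma generates_trans:
  assumes "generates F G" "generates G X"
  shows "generates F X"
proof -
  have fac: "\<exists>vs. set vs \<subseteq> F \<and> concat ws = concat vs" if "set ws \<subseteq> G" for ws
    using that
  proof (induction ws)
    case Nil
    then show ?case by (intro exI[of _ "[]"]) simp
  next
    case (Cons w ws)
    then obtain vs us where "set vs \<subseteq> F" "concat ws = concat vs" "set us \<subseteq> F" "w = concat us"
      using assms(1) by (auto simp: generates_def)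
    then show ?case by (intro exI[of _ "us @ vs"]) simp
  qed
  have "\<exists>vs. set vs \<subseteq> F \<and> x = concat vs" if "x \<in> X" for x
  proof -
    obtain ws where "set ws \<subseteq> G" "x = concat ws" using assms(2) \<open>x \<in> X\<close> unfolding generates_def by blast
    with fac show ?thesis by blast
  qed
  with assms(1) show ?thesis by (simp add: generates_def)
qed

lemma word_rank_map_le:
  assumes "finite X" "[] \<notin> X"
  shows "word_rank (map f ` X) \<le> word_rank X"
proof -
  obtain F where F: "generates F X" "card F = word_rank X" using word_rank_attained[OF assms] .
  have "word_rank (map f ` X) \<le> card (map f ` F)" by (rule word_rank_le[OF generates_map[OF F(1)]])
  also have "\<dots> \<le> card F" using F(1) by (intro card_image_le) (simp add: generates_def)
  finally show ?thesis using F(2) by simp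
qed

text \<open>Let \<open>G\<close> generate \<open>X\<close> with the least number of words. The image \<open>f(G)\<close> generates \<open>f(X)\<close>, so
  equality of ranks forces \<open>f\<close> to be injective on \<open>G\<close> and \<open>f(G)\<close> to be non-defective. Then the cuts of
  \<open>f \<circ> y\<close> into words of \<open>f(G)\<close> are unique, and each of these words has a single preimage in \<open>G\<close>.\<close>
lemma rank_preserving_code_injective:
  assumes X: "finite X" "[] \<notin> X" and rank: "word_rank (map f ` X) = word_rank X"
    and K: "cutting X y K" "cutting X y' K'"
    and eq: "f \<circ> y = f \<circ> y'" and aper: "\<not> periodic (f \<circ> y)"
  shows "y = y'"
proof -
  obtain G where G: "generates G X" "card G = word_rank X" using word_rank_attained[OF X] .
  have fin: "finite G" "[] \<notin> G" using G(1) by (auto simp: generates_def)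
  have gen: "generates (map f ` G) (map f ` X)" by (rule generates_map[OF G(1)])
  have "card (map f ` G) = card G"
    using word_rank_le[OF gen] rank G(2) card_image_le[OF fin(1), of "map f"] by simp
  then have inj: "inj_on (map f) G" by (rule eq_card_imp_inj_on[OF fin(1)])
  have "\<not> defective (map f ` G)"
  proof
    assume "defective (map f ` G)"
    then obtain F where F: "generates F (map f ` G)" "card F < card (map f ` G)"
      unfolding defective_def by blast
    have "word_rank (map f ` X) \<le> card F" by (rule word_rank_le[OF generates_trans[OF F(1) gen]])
    with F(2) rank G(2) \<open>card (map f ` G) = card G\<close> show False by simp
  qed
  moreover obtain C C' where C: "cutting G y C" "cutting G y' C'"
    using cutting_refine[OF K(1) fin(2)] cutting_refine[OF K(2) fin(2)] G(1) unfolding generates_def by metis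
  moreover have "cutting (map f ` G) (f \<circ> y) C'"
    unfolding eq by (rule cutting_map[OF C(2)])
  ultimately have "C = C'"
    using fin aper by (intro unique_cutting[OF _ _ _ cutting_map[OF C(1)], of f C']) auto
  show "y = y'"
  proof
    fix k
    obtain a where a: "a \<in> C" "a \<le> k" "\<And>c. c \<in> C \<Longrightarrow> c \<le> a \<or> k < c"
      using cutting_previous[OF C(1), of k] by metis
    obtain b where b: "consec C a b" using cutting_consec[OF C(1) a(1)] .
    have kb: "k < b" "a \<le> b" using a b unfolding consec_def by force+
    have "segment y a b \<in> G" "segment y' a b \<in> G"
      using C b \<open>C = C'\<close> by (auto simp: cutting_def)
    moreover have "map f (segment y a b) = map f (segment y' a b)"
      unfolding segment_def using fun_cong[OF eq] by simp
    ultimately have "segment y a b = segment y' a b" using inj by (auto dest: inj_onD)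
    then have *: "\<forall>i\<ge>0. i < b - a \<longrightarrow> y (a + i) = y' (a + i)"
      using segment_eq_iff[OF kb(2) kb(2)] by blast
    show "y k = y' k" using spec[OF *, of "k - a"] a(2) kb(1) by simp
  qed
qed

text \<open>If no row determines all others, there are levels \<open>g 0 < g 1 < \<dots>\<close> such that no row \<open>g k\<close>
  determines row \<open>g (k + 1)\<close>. Truncate the words of level \<open>g (L + 1)\<close> to all these levels. By the previous
  lemma the ranks increase strictly with \<open>k\<close>, up to at least \<open>L + 1\<close>, while there
  are at most \<open>L\<close> words.\<close>
theorem some_row_determines_all:
  fixes row :: "nat \<Rightarrow> 'x \<Rightarrow> int \<Rightarrow> 'a" and pr :: "nat \<Rightarrow> 'a \<Rightarrow> 'a"
  assumes row: "\<And>i j x. i \<le> j \<Longrightarrow> x \<in> S \<Longrightarrow> row i x = pr i \<circ> row j x"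
    and pr: "\<And>i j a. i \<le> j \<Longrightarrow> pr i (pr j a) = pr i a"
    and W: "\<And>j. finite (W j)" "\<And>j. [] \<notin> W j" "\<And>j. card (W j) \<le> L"
    and cut: "\<And>j x. x \<in> S \<Longrightarrow> \<exists>K. cutting (W j) (row j x) K"
    and aper: "\<And>i x. i0 \<le> i \<Longrightarrow> x \<in> S \<Longrightarrow> \<not> periodic (row i x)"
  shows "\<exists>i. \<forall>x\<in>S. \<forall>y\<in>S. row i x = row i y \<longrightarrow> (\<forall>j. row j x = row j y)"
proof (rule ccontr)
  assume "\<not> ?thesis"
  then have neg: "\<exists>x\<in>S. \<exists>y\<in>S. \<exists>j. row i x = row i y \<and> row j x \<noteq> row j y" for i by blast
  have "\<exists>j>i. \<exists>x\<in>S. \<exists>y\<in>S. row i x = row i y \<and> row j x \<noteq> row j y" for i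
  proof -
    obtain x y j where *: "x \<in> S" "y \<in> S" "row i x = row i y" "row j x \<noteq> row j y" using neg by blast
    then have "i < j" using row[of j i x] row[of j i y] by (metis linorder_not_le)
    with * show ?thesis by blast
  qed
  then obtain nx where nx: "\<And>i. nx i > i"
      "\<And>i. \<exists>x\<in>S. \<exists>y\<in>S. row i x = row i y \<and> row (nx i) x \<noteq> row (nx i) y"
    by metis
  define g where "g k = (nx ^^ k) i0" for k
  have g: "g (Suc k) = nx (g k)" for k by (simp add: g_def)
  have mono: "strict_mono g" by (rule strict_monoI_Suc) (simp add: g nx)
  have g0: "i0 \<le> g k" for k using strict_mono_less_eq[OF mono, of 0 k] by (simp add: g_def)
  define V where "V = W (g (Suc L))"
  define X where "X k = map (pr (g k)) ` V" for k
  have V: "finite V" "[] \<notin> V" "card V \<le> L" using W by (auto simp: V_def)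
  have X: "finite (X k)" "[] \<notin> X k" for k using V by (auto simp: X_def)
  have step: "map (pr (g k)) ` X (Suc k) = X k" for k
    using strict_mono_less_eq[OF mono, of k "Suc k"] by (simp add: X_def image_image pr o_def)
  have less: "word_rank (X k) < word_rank (X (Suc k))" if "k \<le> L" for k
  proof -
    have le: "word_rank (X k) \<le> word_rank (X (Suc k))"
      using word_rank_map_le[OF X, of "pr (g k)" "Suc k"] by (simp add: step)
    have "word_rank (X k) \<noteq> word_rank (X (Suc k))"
    proof
      assume rank: "word_rank (X k) = word_rank (X (Suc k))"
      obtain x y where xy: "x \<in> S" "y \<in> S" "row (g k) x = row (g k) y"
        "row (g (Suc k)) x \<noteq> row (g (Suc k)) y" using nx(2)[of "g k"] by (auto simp: g)
      have "g k \<le> g (Suc k)" "g (Suc k) \<le> g (Suc L)"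
        using strict_mono_less_eq[OF mono] that by auto
      note r = row[OF this(1)] row[OF this(2)]
      obtain K K' where "cutting V (row (g (Suc L)) x) K" "cutting V (row (g (Suc L)) y) K'"
        using cut[OF xy(1)] cut[OF xy(2)] unfolding V_def by blast
      then have "cutting (X (Suc k)) (row (g (Suc k)) x) K" "cutting (X (Suc k)) (row (g (Suc k)) y) K'"
        unfolding X_def r(2)[OF xy(1)] r(2)[OF xy(2)] by (auto intro: cutting_map)
      moreover have "pr (g k) \<circ> row (g (Suc k)) x = pr (g k) \<circ> row (g (Suc k)) y"
        using r(1) xy by metis
      moreover have "\<not> periodic (pr (g k) \<circ> row (g (Suc k)) x)"
        using aper[OF g0 xy(1)] r(1)[OF xy(1)] by metis
      ultimately show False
        using rank_preserving_code_injective[OF X, of "pr (g k)" "Suc k"] rank xy(4) by (metis step)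
    qed
    with le show ?thesis by simp
  qed
  have "k \<le> word_rank (X k)" if "k \<le> Suc L" for k
    using that
  proof (induction k)
    case (Suc k)
    with less[of k] show ?case by simp
  qed simp
  moreover have "word_rank (X (Suc L)) \<le> L"
    using word_rank_le[OF generates_self[OF X], of "Suc L"] card_image_le[OF V(1)] V(3)
    unfolding X_def by (meson le_trans)
  ultimately show False by (metis Suc_n_not_le_n le_refl le_trans)
qed

section \<open>The Vershik map is a bijection\<close>

lemma least_element_of_finite:
  assumes "finite A" "A \<noteq> {}" "\<And>x y. x \<in> A \<Longrightarrow> y \<in> A \<Longrightarrow> (x, y) \<in> R \<or> (y, x) \<in> R" "trans R"
  shows "\<exists>m\<in>A. \<forall>x\<in>A. (m, x) \<in> R"
  using assms
proof (induction A rule: finite_ne_induct)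
  case (singleton a)
  then show ?case by blast
next
  case (insert a F)
  then obtain m where m: "m \<in> F" "\<forall>x\<in>F. (m, x) \<in> R" by blast
  have aa: "(a, a) \<in> R" using insert by blast
  show ?case
  proof (cases "(a, m) \<in> R")
    case True
    then have "\<forall>x\<in>insert a F. (a, x) \<in> R" using aa m assms(4) by (auto dest: transD)
    then show ?thesis by blast
  next
    case False
    then have "(m, a) \<in> R" using insert(5)[of a m] m by blast
    then show ?thesis using m by blast
  qed
qed

text \<open>Reversing the order exchanges minimal and maximal edges and turns the Vershik map into its
  inverse. Facts about \<open>T'\<close> and about maximal edges are obtained by this duality.\<close>
lemma properly_ordered_converse:
  assumes "properly_ordered B R"
  shows "properly_ordered B (R\<inverse>)"
proof -
  have "min_edges B (R\<inverse>) = max_edges B R" "max_edges B (R\<inverse>) = min_edges B R"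
    by (auto simp: min_edges_def max_edges_def)
  moreover have "partial_order_on (edges B) (R\<inverse>)"
    using assms unfolding properly_ordered_def ordered_diagram_def order_on_defs refl_on_def
    by auto
  moreover have "\<forall>e\<in>edges B. \<forall>f\<in>edges B. (e, f) \<in> R\<inverse> \<or> (f, e) \<in> R\<inverse> \<longleftrightarrow> rng B e = rng B f"
    using assms unfolding properly_ordered_def ordered_diagram_def by auto
  ultimately show ?thesis
    using assms by (simp add: properly_ordered_def ordered_diagram_def)
qed

locale vershik =
  fixes B :: "('v, 'e) bratteli_data" and R :: "'e rel"
  assumes proper: "properly_ordered B R"
begin

abbreviation X where "X \<equiv> path_space B"
abbreviation T where "T \<equiv> vershik_map B R"
abbreviation T' where "T' \<equiv> vershik_map B (R\<inverse>)"

lemma vershik_converse: "vershik B (R\<inverse>)"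
  by (simp add: vershik_def properly_ordered_converse[OF proper])

lemma diagram: "bratteli_diagram B"
  using proper by (simp add: properly_ordered_def ordered_diagram_def)

lemma order: "trans R" "antisym R" "\<And>e. e \<in> edges B \<Longrightarrow> (e, e) \<in> R" "R \<subseteq> edges B \<times> edges B"
  using proper unfolding properly_ordered_def ordered_diagram_def order_on_defs refl_on_def by auto

lemma comparable: "e \<in> edges B \<Longrightarrow> f \<in> edges B \<Longrightarrow> (e, f) \<in> R \<or> (f, e) \<in> R \<longleftrightarrow> rng B e = rng B f"
  using proper unfolding properly_ordered_def ordered_diagram_def by auto

lemma order_rng: "(e, f) \<in> R \<Longrightarrow> rng B e = rng B f"
  using comparable order(4) by blast

lemma edge:
  assumes "e \<in> Edg B n" "1 \<le> n"
  shows "e \<in> edges B" "src B e \<in> Vtx B (n - 1)" "rng B e \<in> Vtx B n"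
  using assms diagram unfolding bratteli_diagram_def edges_def by auto

lemma edge_level:
  assumes "e \<in> edges B" "rng B e \<in> Vtx B n"
  shows "e \<in> Edg B n" "1 \<le> n"
proof -
  obtain m where m: "1 \<le> m" "e \<in> Edg B m" using assms(1) by (auto simp: edges_def)
  then have "rng B e \<in> Vtx B m" using edge by blast
  moreover have "disjoint_family (Vtx B)" using diagram by (simp add: bratteli_diagram_def)
  ultimately have "m = n" using assms(2) unfolding disjoint_family_on_def by blast
  with m show "e \<in> Edg B n" "1 \<le> n" by auto
qed

lemma same_rng_level: "e \<in> Edg B n \<Longrightarrow> 1 \<le> n \<Longrightarrow> f \<in> edges B \<Longrightarrow> rng B f = rng B e \<Longrightarrow> f \<in> Edg B n"
  using edge edge_level by metis

lemma finite_Edg: "1 \<le> n \<Longrightarrow> finite (Edg B n)"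
  using diagram by (simp add: bratteli_diagram_def)

lemma finite_Vtx: "finite (Vtx B n)"
  using diagram by (simp add: bratteli_diagram_def)

lemma finite_comparable: "e \<in> edges B \<Longrightarrow> finite {f \<in> edges B. rng B f = rng B e}"
proof -
  assume e: "e \<in> edges B"
  then obtain n where n: "1 \<le> n" "e \<in> Edg B n" by (auto simp: edges_def)
  show ?thesis
    by (rule finite_subset[OF _ finite_Edg[OF n(1)]]) (use n same_rng_level in auto)
qed

lemma min_edge_exists:
  assumes "v \<in> Vtx B n" "1 \<le> n"
  shows "\<exists>e\<in>Edg B n. rng B e = v \<and> e \<in> min_edges B R"
proof -
  obtain e where e: "e \<in> Edg B n" "rng B e = v"
    using assms diagram unfolding bratteli_diagram_def by blast
  have eE: "e \<in> edges B" using edge e(1) assms(2) by blast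
  let ?A = "{f \<in> edges B. rng B f = rng B e}"
  have "\<exists>m\<in>?A. \<forall>f\<in>?A. (m, f) \<in> R"
  proof (rule least_element_of_finite[OF finite_comparable[OF eE]])
    show "?A \<noteq> {}" using eE by blast
    show "trans R" by (rule order)
    show "x \<in> ?A \<Longrightarrow> y \<in> ?A \<Longrightarrow> (x, y) \<in> R \<or> (y, x) \<in> R" for x y using comparable by auto
  qed
  then obtain m where m: "m \<in> ?A" "\<forall>f\<in>?A. (m, f) \<in> R" by blast
  have "f = m" if "f \<in> edges B" "(f, m) \<in> R" for f
  proof -
    have "f \<in> ?A" using that order_rng[OF that(2)] m(1) by simp
    with m(2) that(2) show "f = m" using order(2) by (auto dest: antisymD)
  qed
  then have "m \<in> min_edges B R" using m(1) by (auto simp: min_edges_def)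
  moreover have "m \<in> Edg B n" using m(1) e assms(2) same_rng_level by auto
  ultimately show ?thesis using m(1) e by blast
qed

lemma min_edge_unique:
  assumes "e \<in> min_edges B R" "f \<in> min_edges B R" "rng B e = rng B f"
  shows "e = f"
  using assms comparable[of e f] unfolding min_edges_def by auto

lemma edge_succ:
  assumes "e \<in> edges B" "e \<notin> max_edges B R"
  shows "edge_succ B R e \<in> edges B" "(e, edge_succ B R e) \<in> R" "edge_succ B R e \<noteq> e"
    "\<And>g. (e, g) \<in> R \<Longrightarrow> g \<noteq> e \<Longrightarrow> (edge_succ B R e, g) \<in> R"
proof -
  let ?A = "{f \<in> edges B. (e, f) \<in> R \<and> f \<noteq> e}"
  have "finite ?A"
    by (rule finite_subset[OF _ finite_comparable[OF assms(1)]]) (auto dest: order_rng)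
  moreover have "?A \<noteq> {}" using assms by (auto simp: max_edges_def)
  moreover have "x \<in> ?A \<Longrightarrow> y \<in> ?A \<Longrightarrow> (x, y) \<in> R \<or> (y, x) \<in> R" for x y
  proof -
    assume "x \<in> ?A" "y \<in> ?A"
    then have "x \<in> edges B" "y \<in> edges B" "rng B x = rng B y"
      using order_rng[of e x] order_rng[of e y] by auto
    then show ?thesis using comparable by blast
  qed
  ultimately obtain m where m: "m \<in> ?A" "\<forall>f\<in>?A. (m, f) \<in> R"
    using least_element_of_finite[of ?A R] order(1) by blast
  have "edge_succ B R e = m"
    unfolding edge_succ_def
  proof (rule the_equality)
    show "m \<in> edges B \<and> (e, m) \<in> R \<and> m \<noteq> e \<and> (\<forall>g\<in>edges B. (e, g) \<in> R \<and> g \<noteq> e \<longrightarrow> (m, g) \<in> R)"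
      using m by blast
    fix f assume "f \<in> edges B \<and> (e, f) \<in> R \<and> f \<noteq> e \<and> (\<forall>g\<in>edges B. (e, g) \<in> R \<and> g \<noteq> e \<longrightarrow> (f, g) \<in> R)"
    then show "f = m" using m order(2) by (auto dest: antisymD)
  qed
  with m order(4) show "edge_succ B R e \<in> edges B" "(e, edge_succ B R e) \<in> R" "edge_succ B R e \<noteq> e"
    "\<And>g. (e, g) \<in> R \<Longrightarrow> g \<noteq> e \<Longrightarrow> (edge_succ B R e, g) \<in> R"
    by auto
qed

lemma edge_succ_not_min:
  assumes "e \<in> edges B" "e \<notin> max_edges B R"
  shows "edge_succ B R e \<notin> min_edges B R"
proof
  assume "edge_succ B R e \<in> min_edges B R"
  then have "e = edge_succ B R e" using edge_succ(2)[OF assms] assms(1) by (simp add: min_edges_def)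
  with edge_succ(3)[OF assms] show False by simp
qed

lemma edge_succ_converse:
  assumes "e \<in> edges B" "e \<notin> max_edges B R"
  shows "edge_succ B (R\<inverse>) (edge_succ B R e) = e"
proof -
  let ?f = "edge_succ B R e"
  note f = edge_succ[OF assms]
  show ?thesis
    unfolding edge_succ_def[of _ "R\<inverse>"]
  proof (rule the_equality)
    have "(g, e) \<in> R" if g: "g \<in> edges B" "(g, ?f) \<in> R" "g \<noteq> ?f" for g
    proof (rule ccontr)
      assume "(g, e) \<notin> R"
      moreover have "rng B g = rng B e" using order_rng f(2) g(2) by metis
      ultimately have "(e, g) \<in> R" "g \<noteq> e" using comparable[of g e] g(1) assms(1) order(3) by auto
      then have "(?f, g) \<in> R" by (rule f(4))
      with g order(2) show False by (auto dest: antisymD)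
    qed
    with f assms(1) show "e \<in> edges B \<and> (?f, e) \<in> R\<inverse> \<and> e \<noteq> ?f \<and>
        (\<forall>g\<in>edges B. (?f, g) \<in> R\<inverse> \<and> g \<noteq> ?f \<longrightarrow> (e, g) \<in> R\<inverse>)" by auto
    fix h assume h: "h \<in> edges B \<and> (?f, h) \<in> R\<inverse> \<and> h \<noteq> ?f \<and>
        (\<forall>g\<in>edges B. (?f, g) \<in> R\<inverse> \<and> g \<noteq> ?f \<longrightarrow> (h, g) \<in> R\<inverse>)"
    then have "(e, h) \<in> R" using f(2,3) assms(1) by auto
    show "h = e"
    proof (rule ccontr)
      assume "h \<noteq> e"
      with \<open>(e, h) \<in> R\<close> have "(?f, h) \<in> R" using f(4) by blast
      with h order(2) show False by (auto dest: antisymD)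
    qed
  qed
qed

definition agree :: "nat \<Rightarrow> (nat \<Rightarrow> 'e) \<Rightarrow> (nat \<Rightarrow> 'e) \<Rightarrow> bool" where
  "agree n x y \<longleftrightarrow> (\<forall>i. 1 \<le> i \<longrightarrow> i \<le> n \<longrightarrow> x i = y i)"

text \<open>The paths through a vertex of level \<open>n\<close> with varying initial segments form a tower of the
  Kakutani--Rokhlin partition of level \<open>n\<close>. The next two predicates describe its bottom and top floors.\<close>
definition bottom :: "nat \<Rightarrow> (nat \<Rightarrow> 'e) \<Rightarrow> bool" where
  "bottom n x \<longleftrightarrow> (\<forall>i. 1 \<le> i \<longrightarrow> i \<le> n \<longrightarrow> x i \<in> min_edges B R)"

definition top_floor :: "nat \<Rightarrow> (nat \<Rightarrow> 'e) \<Rightarrow> bool" where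
  "top_floor n x \<longleftrightarrow> (\<forall>i. 1 \<le> i \<longrightarrow> i \<le> n \<longrightarrow> x i \<in> max_edges B R)"

definition chain :: "nat \<Rightarrow> (nat \<Rightarrow> 'e) \<Rightarrow> bool" where
  "chain n p \<longleftrightarrow> (\<forall>i. 1 \<le> i \<longrightarrow> i \<le> n \<longrightarrow> p i \<in> Edg B i) \<and>
     (\<forall>i. 1 \<le> i \<longrightarrow> i < n \<longrightarrow> rng B (p i) = src B (p (Suc i)))"

text \<open>Taking the source of the next edge, not the range of the \<open>n\<close>-th one, makes this meaningful at
  level 0.\<close>
definition vertex :: "(nat \<Rightarrow> 'e) \<Rightarrow> nat \<Rightarrow> 'v" where
  "vertex x n = src B (x (Suc n))"

lemma agree_refl [simp]: "agree n x x" by (simp add: agree_def)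

lemma agree_sym: "agree n x y \<Longrightarrow> agree n y x" by (simp add: agree_def)

lemma agree_trans: "agree n x y \<Longrightarrow> agree n y z \<Longrightarrow> agree n x z" by (simp add: agree_def)

lemma agree_mono: "agree n x y \<Longrightarrow> m \<le> n \<Longrightarrow> agree m x y" by (simp add: agree_def)

lemma path:
  assumes "x \<in> X"
  shows "\<And>i. 1 \<le> i \<Longrightarrow> x i \<in> Edg B i" "\<And>i. 1 \<le> i \<Longrightarrow> x i \<in> edges B"
    "\<And>i. 1 \<le> i \<Longrightarrow> rng B (x i) = vertex x i" "\<And>n. vertex x n \<in> Vtx B n" "x 0 = undefined"
    "chain n x"
proof -
  show e: "x i \<in> Edg B i" if "1 \<le> i" for i using assms that by (auto simp: path_space_def)
  then show "x i \<in> edges B" if "1 \<le> i" for i using edge that by blast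
  show "rng B (x i) = vertex x i" if "1 \<le> i" for i
    using assms that by (auto simp: path_space_def vertex_def)
  show "vertex x n \<in> Vtx B n" for n
    using edge(2)[OF e[of "Suc n"]] by (simp add: vertex_def)
  show "x 0 = undefined" using assms by (auto simp: path_space_def PiE_def extensional_def)
  show "chain n x" using assms e by (auto simp: path_space_def chain_def)
qed

lemma path_spaceI:
  assumes "\<And>i. 1 \<le> i \<Longrightarrow> x i \<in> Edg B i" "\<And>i. 1 \<le> i \<Longrightarrow> rng B (x i) = src B (x (Suc i))" "x 0 = undefined"
  shows "x \<in> X"
  using assms by (auto simp: path_space_def PiE_def extensional_def not_le)

lemma path_eqI:
  assumes "x \<in> X" "y \<in> X" "\<And>i. 1 \<le> i \<Longrightarrow> x i = y i"
  shows "x = y"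
proof
  fix i show "x i = y i" using assms path(5)[OF assms(1)] path(5)[OF assms(2)] by (cases i) auto
qed

lemma path_eq_if_agree:
  assumes "x \<in> X" "y \<in> X" "\<And>n. agree n x y"
  shows "x = y"
  using assms by (intro path_eqI) (auto simp: agree_def)

lemma continue_to_infinity:
  assumes "v \<in> Vtx B n"
  shows "\<exists>z. (\<forall>i>n. z i \<in> Edg B i \<and> rng B (z i) = src B (z (Suc i))) \<and> src B (z (Suc n)) = v"
proof -
  define out where "out k u = (SOME e. e \<in> Edg B (Suc k) \<and> src B e = u)" for k u
  have out: "out k u \<in> Edg B (Suc k) \<and> src B (out k u) = u" if "u \<in> Vtx B k" for k u
  proof -
    have "\<exists>e. e \<in> Edg B (Suc k) \<and> src B e = u"
      using that diagram unfolding bratteli_diagram_def by blast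
    then show ?thesis unfolding out_def by (rule someI_ex)
  qed
  define u where "u = rec_nat v (\<lambda>k w. rng B (out (n + k) w))"
  have u0: "u 0 = v" and us: "u (Suc k) = rng B (out (n + k) (u k))" for k by (auto simp: u_def)
  have uV: "u k \<in> Vtx B (n + k)" for k
  proof (induction k)
    case (Suc k)
    then show ?case using out edge(3)[of _ "Suc (n + k)"] us by simp
  qed (simp add: u0 assms)
  define z where "z i = out (i - 1) (u (i - 1 - n))" for i
  have z: "z (Suc (n + k)) = out (n + k) (u k)" for k by (simp add: z_def)
  have "z i \<in> Edg B i \<and> rng B (z i) = src B (z (Suc i))" if "n < i" for i
  proof -
    have "\<exists>k. i = Suc (n + k)" using that by (rule less_imp_Suc_add)
    then obtain k where k: "i = Suc (n + k)" ..
    show ?thesis using out[OF uV[of k]] out[OF uV[of "Suc k"]] z[of k] z[of "Suc k"] us k by simp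
  qed
  moreover have "src B (z (Suc n)) = v" using z[of 0] out[OF uV[of 0]] u0 by simp
  ultimately show ?thesis by blast
qed

lemma chain_extends:
  assumes "chain n p" "v \<in> Vtx B n" "1 \<le> n \<Longrightarrow> rng B (p n) = v"
  shows "\<exists>z\<in>X. agree n z p \<and> vertex z n = v"
proof -
  obtain y where y: "\<And>i. i > n \<Longrightarrow> y i \<in> Edg B i \<and> rng B (y i) = src B (y (Suc i))" "src B (y (Suc n)) = v"
    using continue_to_infinity[OF assms(2)] by blast
  define z where "z i = (if i = 0 then undefined else if i \<le> n then p i else y i)" for i
  have "z \<in> X"
  proof (rule path_spaceI)
    fix i :: nat assume i: "1 \<le> i"
    show "z i \<in> Edg B i" using i assms(1) y by (auto simp: z_def chain_def)
    consider "i < n" | "i = n" | "n < i" by linarith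
    then show "rng B (z i) = src B (z (Suc i))"
      using i assms(1,3) y by cases (auto simp: z_def chain_def)
  qed (simp add: z_def)
  moreover have "agree n z p" by (simp add: agree_def z_def)
  moreover have "vertex z n = v" using y(2) by (simp add: vertex_def z_def)
  ultimately show ?thesis by blast
qed

lemma min_chain_unique:
  assumes "chain n p" "chain n q" "bottom n p" "bottom n q" "1 \<le> n \<Longrightarrow> rng B (p n) = rng B (q n)"
  shows "agree n p q"
  using assms
proof (induction n)
  case (Suc n)
  have eq: "p (Suc n) = q (Suc n)"
    using Suc.prems min_edge_unique by (auto simp: bottom_def)
  moreover have "agree n p q"
  proof (rule Suc.IH)
    show "1 \<le> n \<Longrightarrow> rng B (p n) = rng B (q n)"
      using Suc.prems(1,2) eq by (simp add: chain_def)
  qed (use Suc.prems in \<open>auto simp: chain_def bottom_def\<close>)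
  ultimately show ?case by (auto simp: agree_def le_Suc_eq)
qed (simp add: agree_def)

lemma bottom_unique:
  assumes "x \<in> X" "y \<in> X" "bottom n x" "bottom n y" "vertex x n = vertex y n"
  shows "agree n x y"
  by (rule min_chain_unique) (use assms path in auto)

lemma bottom_exists:
  assumes "v \<in> Vtx B n"
  shows "\<exists>z\<in>X. bottom n z \<and> vertex z n = v"
proof -
  have "\<exists>p. chain n p \<and> bottom n p \<and> (1 \<le> n \<longrightarrow> rng B (p n) = v)"
    using assms
  proof (induction n arbitrary: v)
    case 0
    then show ?case by (simp add: chain_def bottom_def)
  next
    case (Suc n)
    obtain e where e: "e \<in> Edg B (Suc n)" "rng B e = v" "e \<in> min_edges B R"
      using min_edge_exists[OF Suc.prems] by auto
    have "src B e \<in> Vtx B n" using edge(2)[OF e(1)] by simp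
    then obtain p where p: "chain n p" "bottom n p" "1 \<le> n \<longrightarrow> rng B (p n) = src B e"
      using Suc.IH by blast
    then show ?case using e
      by (intro exI[of _ "p(Suc n := e)"]) (auto simp: chain_def bottom_def le_Suc_eq less_Suc_eq)
  qed
  then obtain p where p: "chain n p" "bottom n p" "1 \<le> n \<longrightarrow> rng B (p n) = v" by blast
  then obtain z where "z \<in> X" "agree n z p" "vertex z n = v"
    using chain_extends[OF p(1) assms] by blast
  moreover have "bottom n z" using p(2) \<open>agree n z p\<close> by (auto simp: bottom_def agree_def)
  ultimately show ?thesis by blast
qed

lemma x_min: "x_min B R \<in> X" "bottom n (x_min B R)"
  and x_min_unique: "x \<in> X \<Longrightarrow> (\<And>n. bottom n x) \<Longrightarrow> x = x_min B R"
proof -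
  have ex: "\<exists>!x. x \<in> X \<and> (\<forall>i\<ge>1. x i \<in> min_edges B R)"
    using proper by (simp add: properly_ordered_def)
  from theI'[OF ex] have m: "x_min B R \<in> X" "\<forall>i\<ge>1. x_min B R i \<in> min_edges B R"
    by (auto simp: x_min_def)
  then show "x_min B R \<in> X" "bottom n (x_min B R)" by (auto simp: bottom_def)
  assume "x \<in> X" "\<And>n. bottom n x"
  then have "x \<in> X \<and> (\<forall>i\<ge>1. x i \<in> min_edges B R)" by (auto simp: bottom_def)
  with ex m show "x = x_min B R" by blast
qed

lemma x_max: "x_max B R \<in> X" "top_floor n (x_max B R)"
  and x_max_unique: "x \<in> X \<Longrightarrow> (\<And>n. top_floor n x) \<Longrightarrow> x = x_max B R"
proof -
  have ex: "\<exists>!x. x \<in> X \<and> (\<forall>i\<ge>1. x i \<in> max_edges B R)"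
    using proper by (simp add: properly_ordered_def)
  from theI'[OF ex] have m: "x_max B R \<in> X" "\<forall>i\<ge>1. x_max B R i \<in> max_edges B R"
    by (auto simp: x_max_def)
  then show "x_max B R \<in> X" "top_floor n (x_max B R)" by (auto simp: top_floor_def)
  assume "x \<in> X" "\<And>n. top_floor n x"
  then have "x \<in> X \<and> (\<forall>i\<ge>1. x i \<in> max_edges B R)" by (auto simp: top_floor_def)
  with ex m show "x = x_max B R" by blast
qed

lemma first_non_max:
  assumes "x \<in> X" "\<not> top_floor n x"
  obtains k where "1 \<le> k" "k \<le> n" "top_floor (k - 1) x" "x k \<notin> max_edges B R"
proof -
  define P where "P k \<longleftrightarrow> 1 \<le> k \<and> x k \<notin> max_edges B R" for k
  obtain j where j: "P j" "j \<le> n" using assms(2) by (auto simp: P_def top_floor_def)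
  define k where "k = (LEAST k. P k)"
  have "P k" "k \<le> j" unfolding k_def using LeastI[of P j] Least_le[of P j] j by auto
  moreover have "top_floor (k - 1) x"
    unfolding top_floor_def
  proof (intro allI impI)
    fix i assume i: "1 \<le> i" "i \<le> k - 1"
    then have "i < k" by simp
    then have "\<not> P i" unfolding k_def by (rule not_less_Least)
    with i show "x i \<in> max_edges B R" by (simp add: P_def)
  qed
  ultimately show thesis using that j by (auto simp: P_def)
qed

lemma vershik_step:
  assumes x: "x \<in> X" and n: "1 \<le> n" "top_floor (n - 1) x" "x n \<notin> max_edges B R"
  shows "T x \<in> X" "\<And>i. n < i \<Longrightarrow> T x i = x i" "T x n = edge_succ B R (x n)" "bottom (n - 1) (T x)"
proof -
  have least: "(LEAST k. 1 \<le> k \<and> x k \<notin> max_edges B R) = n"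
  proof (rule Least_equality)
    fix k assume k: "1 \<le> k \<and> x k \<notin> max_edges B R"
    show "n \<le> k"
    proof (rule ccontr)
      assume "\<not> n \<le> k"
      then have "k \<le> n - 1" by simp
      with k n(2) show False by (auto simp: top_floor_def)
    qed
  qed (use n in auto)
  have nm: "x \<noteq> x_max B R" using x_max(2)[of n] n by (auto simp: top_floor_def)
  define f where "f = edge_succ B R (x n)"
  have xn: "x n \<in> edges B" "x n \<in> Edg B n" using path[OF x] n by auto
  note fs = edge_succ[OF xn(1) n(3), folded f_def]
  have fr: "rng B f = rng B (x n)" using order_rng[OF fs(2)] by simp
  have fE: "f \<in> Edg B n" by (rule same_rng_level[OF xn(2) n(1) fs(1) fr])
  then have "src B f \<in> Vtx B (n - 1)" using edge n by blast
  then obtain q where q: "q \<in> X" "bottom (n - 1) q" "vertex q (n - 1) = src B f"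
    using bottom_exists by blast
  define p where "p = map q [1..<n]"
  have pth: "min_path_to_edge B R n f = p"
    unfolding min_path_to_edge_def
  proof (rule the_equality)
    have "p \<in> finite_paths B 0 (n - 1)"
      using path[OF q(1)] by (auto simp: finite_paths_def p_def vertex_def)
    moreover have "set p \<subseteq> min_edges B R" using q(2) by (auto simp: p_def bottom_def)
    moreover have "rng B (last p) = src B f" if "p \<noteq> []"
      using that q(3) path(3)[OF q(1), of "n - 1"] by (auto simp: p_def last_map)
    ultimately show "p \<in> finite_paths B 0 (n - 1) \<and> set p \<subseteq> min_edges B R \<and>
      (p \<noteq> [] \<longrightarrow> rng B (last p) = src B f)" by blast
  next
    fix p' assume p': "p' \<in> finite_paths B 0 (n - 1) \<and> set p' \<subseteq> min_edges B R \<and>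
      (p' \<noteq> [] \<longrightarrow> rng B (last p') = src B f)"
    then have len: "length p' = n - 1" by (simp add: finite_paths_def)
    define r where "r i = p' ! (i - 1)" for i
    have "chain (n - 1) r"
      unfolding chain_def
    proof (intro conjI allI impI)
      fix i assume "1 \<le> i" "i \<le> n - 1"
      then obtain j where "i = Suc j" "j < n - 1" by (cases i) auto
      then show "r i \<in> Edg B i" using p' by (auto simp: finite_paths_def r_def)
    next
      fix i assume "1 \<le> i" "i < n - 1"
      then obtain j where "i = Suc j" "Suc j < n - 1" by (cases i) auto
      then show "rng B (r i) = src B (r (Suc i))" using p' by (auto simp: finite_paths_def r_def)
    qed
    moreover have "bottom (n - 1) r"
      unfolding bottom_def
    proof (intro allI impI)
      fix i assume "1 \<le> i" "i \<le> n - 1"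
      then have "r i \<in> set p'" using len unfolding r_def by (intro nth_mem) auto
      then show "r i \<in> min_edges B R" using p' by blast
    qed
    moreover have "rng B (r (n - 1)) = rng B (q (n - 1))" if "1 \<le> n - 1"
    proof -
      have "p' \<noteq> []" using that len by auto
      then have "rng B (r (n - 1)) = src B f" using p' len by (simp add: last_conv_nth r_def)
      with q(3) path(3)[OF q(1) that] show ?thesis by simp
    qed
    ultimately have ag: "agree (n - 1) r q"
      using min_chain_unique[of "n - 1" r q] path(6)[OF q(1)] q(2) by blast
    show "p' = p"
    proof (rule nth_equalityI)
      fix i assume "i < length p'"
      then have "r (Suc i) = q (Suc i)" using ag len by (auto simp: agree_def)
      then show "p' ! i = p ! i" using \<open>i < length p'\<close> len by (simp add: r_def p_def)
    qed (simp add: len p_def)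
  qed
  have Tx: "T x = (\<lambda>i\<in>{1..}. if i < n then p ! (i - 1) else if i = n then f else x i)"
    unfolding vershik_map_def least Let_def f_def[symmetric] pth using nm by simp
  then have low: "T x i = q i" if "1 \<le> i" "i < n" for i
    using that by (simp add: p_def nth_append)
  show tail: "T x i = x i" if "n < i" for i using that n Tx by auto
  show Tn: "T x n = edge_succ B R (x n)" using Tx n by (simp add: f_def)
  show "bottom (n - 1) (T x)"
    unfolding bottom_def
  proof (intro allI impI)
    fix i assume "1 \<le> i" "i \<le> n - 1"
    then show "T x i \<in> min_edges B R" using low[of i] q(2) by (auto simp: bottom_def)
  qed
  show "T x \<in> X"
  proof (rule path_spaceI)
    fix i :: nat assume i: "1 \<le> i"
    consider "i < n" | "i = n" | "n < i" by linarith
    then show "T x i \<in> Edg B i"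
      using i low tail Tn fE path[OF x] path[OF q(1)] by cases (auto simp: f_def)
    consider "Suc i < n" | "Suc i = n" | "i = n" | "n < i" by linarith
    then show "rng B (T x i) = src B (T x (Suc i))"
    proof cases
      case 1
      then show ?thesis using i low path(3)[OF q(1) i] by (simp add: vertex_def)
    next
      case 2
      then show ?thesis using i low[of i] q(3) path(3)[OF q(1) i] Tn by (auto simp: f_def)
    next
      case 3
      then show ?thesis using i Tn tail path(3)[OF x i] fr by (simp add: f_def vertex_def)
    next
      case 4
      then show ?thesis using i tail path(3)[OF x i] by (simp add: vertex_def)
    qed
  next
    show "T x 0 = undefined" using Tx by simp
  qed
qed

lemma vershik_x_max: "T (x_max B R) = x_min B R"
  by (simp add: vershik_map_def)

lemma vershik_cases:
  assumes "x \<in> X"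
  obtains "x = x_max B R" | n where "1 \<le> n" "top_floor (n - 1) x" "x n \<notin> max_edges B R"
proof (cases "\<forall>n. top_floor n x")
  case True
  then show thesis using that(1) x_max_unique assms by blast
next
  case False
  then show thesis using that(2) first_non_max[OF assms] by metis
qed

lemma T_closed: "x \<in> X \<Longrightarrow> T x \<in> X"
  using vershik_cases vershik_step(1) vershik_x_max x_min(1) by metis

text \<open>Below the top floor the map moves a path up in its tower and leaves the edges after level \<open>n\<close>
  alone. How it moves depends on the initial segment only.\<close>
lemma not_top_floor:
  assumes x: "x \<in> X" and n: "\<not> top_floor n x"
  shows "\<not> bottom n (T x)" "vertex (T x) n = vertex x n" "\<And>i. n < i \<Longrightarrow> T x i = x i"
    "\<And>y. y \<in> X \<Longrightarrow> agree n x y \<Longrightarrow> agree n (T x) (T y)"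
proof -
  obtain k where k: "1 \<le> k" "k \<le> n" "top_floor (k - 1) x" "x k \<notin> max_edges B R"
    using first_non_max[OF x n] .
  note s = vershik_step[OF x k(1,3,4)]
  have "T x k \<notin> min_edges B R"
    using s(3) edge_succ_not_min path(2)[OF x k(1)] k(4) by simp
  with k show "\<not> bottom n (T x)" by (auto simp: bottom_def)
  show tail: "T x i = x i" if "n < i" for i using s(2) that k by simp
  then show "vertex (T x) n = vertex x n" by (simp add: vertex_def)
  fix y assume y: "y \<in> X" "agree n x y"
  have "x i = y i" if "1 \<le> i" "i \<le> k" for i using y(2) that k by (auto simp: agree_def)
  then have ky: "top_floor (k - 1) y" "y k \<notin> max_edges B R" "y k = x k"
    using k by (auto simp: top_floor_def)
  note sy = vershik_step[OF y(1) k(1) ky(1,2)]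
  have "vertex (T x) (k - 1) = vertex (T y) (k - 1)"
    using s(3) sy(3) ky(3) k(1) by (simp add: vertex_def)
  then have ag: "agree (k - 1) (T x) (T y)"
    by (rule bottom_unique[OF s(1) sy(1) s(4) sy(4)])
  have "T x k = T y k" using s(3) sy(3) ky(3) by simp
  have high: "T x i = T y i" if "k < i" "i \<le> n" for i
    using s(2) sy(2) that y(2) by (simp add: agree_def)
  show "agree n (T x) (T y)"
    unfolding agree_def
  proof (intro allI impI)
    fix i assume "1 \<le> i" "i \<le> n"
    moreover consider "i \<le> k - 1" | "i = k" | "k < i" by linarith
    ultimately show "T x i = T y i"
      using ag \<open>T x k = T y k\<close> high by cases (auto simp: agree_def)
  qed
qed

lemma top_floor_bottom:
  assumes x: "x \<in> X" and n: "top_floor n x"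
  shows "bottom n (T x)"
  using x
proof (cases rule: vershik_cases)
  case 1
  then show ?thesis using vershik_x_max x_min(2) by simp
next
  case (2 k)
  have "n < k" using n 2 by (meson top_floor_def linorder_not_le)
  then have "n \<le> k - 1" by simp
  then show ?thesis using vershik_step(4)[OF x 2] by (auto simp: bottom_def)
qed

lemma converse_notions:
  "vershik.bottom B (R\<inverse>) = top_floor" "vershik.top_floor B (R\<inverse>) = bottom"
  "x_min B (R\<inverse>) = x_max B R" "x_max B (R\<inverse>) = x_min B R"
proof -
  have m: "min_edges B (R\<inverse>) = max_edges B R" "max_edges B (R\<inverse>) = min_edges B R"
    by (auto simp: min_edges_def max_edges_def)
  show "vershik.bottom B (R\<inverse>) = top_floor" "vershik.top_floor B (R\<inverse>) = bottom"
    by (auto simp: fun_eq_iff vershik.bottom_def[OF vershik_converse]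
        vershik.top_floor_def[OF vershik_converse] bottom_def top_floor_def m)
  show "x_min B (R\<inverse>) = x_max B R" "x_max B (R\<inverse>) = x_min B R"
    by (simp_all add: x_min_def x_max_def m)
qed

lemma T'_T:
  assumes x: "x \<in> X"
  shows "T' (T x) = x"
  using x
proof (cases rule: vershik_cases)
  case 1
  then show ?thesis
    using vershik_x_max vershik.vershik_x_max[OF vershik_converse] by (simp add: converse_notions)
next
  case (2 n)
  note s = vershik_step[OF x 2]
  have xn: "x n \<in> edges B" using path(2)[OF x 2(1)] .
  have mm: "max_edges B (R\<inverse>) = min_edges B R" by (auto simp: min_edges_def max_edges_def)
  have nm: "T x n \<notin> max_edges B (R\<inverse>)"
    unfolding mm using s(3) edge_succ_not_min[OF xn 2(3)] by simp
  note s' = vershik.vershik_step[OF vershik_converse s(1) 2(1), unfolded converse_notions, OF s(4) nm]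
  have n': "T' (T x) n = x n" using s'(3) s(3) edge_succ_converse[OF xn 2(3)] by simp
  have "vertex (T' (T x)) (n - 1) = vertex x (n - 1)" using n' 2(1) by (simp add: vertex_def)
  then have "agree (n - 1) (T' (T x)) x"
    using vershik.bottom_unique[OF vershik_converse s'(1) x, unfolded converse_notions, OF s'(4) 2(2)]
    by (simp add: vershik.vertex_def[OF vershik_converse] vertex_def
        vershik.agree_def[OF vershik_converse] agree_def)
  show ?thesis
  proof (rule path_eqI[OF s'(1) x])
    fix i :: nat assume "1 \<le> i"
    consider "i < n" | "i = n" | "n < i" by linarith
    then show "T' (T x) i = x i"
      using n' s(2) s'(2) \<open>agree (n - 1) _ _\<close> \<open>1 \<le> i\<close> by cases (auto simp: agree_def)
  qed
qed

lemma T_T': "x \<in> X \<Longrightarrow> T (T' x) = x"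
  using vershik.T'_T[OF vershik_converse] by simp

lemma T'_closed: "x \<in> X \<Longrightarrow> T' x \<in> X"
  using vershik.T_closed[OF vershik_converse] by simp

lemma T_bij: "bij_betw T X X"
  by (rule bij_betw_byWitness[of _ T']) (auto simp: T'_T T_T' T_closed T'_closed)

lemma T_funpow_closed: "x \<in> X \<Longrightarrow> (T ^^ n) x \<in> X"
  by (induction n) (auto simp: T_closed)

text \<open>Induction on the level: once the top floor of level \<open>n\<close> is reached, the next step replaces the
  edge of level \<open>n + 1\<close> by its successor, and there are finitely many edges above it.\<close>
lemma reach_top_floor:
  "x \<in> X \<Longrightarrow> \<exists>N. top_floor n ((T ^^ N) x) \<and> (\<forall>i>n. (T ^^ N) x i = x i)"
proof (induction n arbitrary: x)
  case 0
  then show ?case by (intro exI[of _ 0]) (auto simp: top_floor_def)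
next
  case (Suc n)
  let ?up = "\<lambda>e. {g \<in> edges B. (e, g) \<in> R}"
  show ?case using Suc.prems
  proof (induction "card (?up (x (Suc n)))" arbitrary: x rule: less_induct)
    case less
    obtain N where N: "top_floor n ((T ^^ N) x)" "\<forall>i>n. (T ^^ N) x i = x i"
      using Suc.IH[OF less.prems] by blast
    let ?y = "(T ^^ N) x"
    have y: "?y \<in> X" using T_funpow_closed less.prems by blast
    show ?case
    proof (cases "x (Suc n) \<in> max_edges B R")
      case True
      then have "top_floor (Suc n) ?y" using N by (auto simp: top_floor_def le_Suc_eq)
      with N show ?thesis by auto
    next
      case False
      let ?e = "x (Suc n)"
      have e: "?e \<in> edges B" using path(2)[OF less.prems] by simp
      note es = edge_succ[OF e False]
      have "?y (Suc n) \<notin> max_edges B R" using N False by simp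
      note s = vershik_step[OF y _ _ this, simplified, OF N(1)]
      have "?up (edge_succ B R ?e) \<subset> ?up ?e"
      proof
        show "?up (edge_succ B R ?e) \<subseteq> ?up ?e" using es(2) order(1) by (auto dest: transD)
        have "?e \<notin> ?up (edge_succ B R ?e)" using es order(2) by (auto dest: antisymD)
        moreover have "?e \<in> ?up ?e" using e order(3) by simp
        ultimately show "?up (edge_succ B R ?e) \<noteq> ?up ?e" by blast
      qed
      moreover have "finite (?up ?e)"
        by (rule finite_subset[OF _ finite_comparable[OF e]]) (auto dest: order_rng)
      ultimately have "card (?up (edge_succ B R ?e)) < card (?up ?e)" by (rule psubset_card_mono[rotated])
      moreover have "T ?y (Suc n) = edge_succ B R ?e" using s(3) N(2) by simp
      ultimately have "\<exists>M. top_floor (Suc n) ((T ^^ M) (T ?y)) \<and> (\<forall>i>Suc n. (T ^^ M) (T ?y) i = T ?y i)"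
        using less.hyps[of "T ?y"] s(1) by simp
      then obtain M where M: "top_floor (Suc n) ((T ^^ M) (T ?y))" "\<forall>i>Suc n. (T ^^ M) (T ?y) i = T ?y i"
        by blast
      have "(T ^^ (M + Suc N)) x = (T ^^ M) (T ?y)" by (simp add: funpow_add funpow_swap1)
      then show ?thesis using M s(2) N(2) by (intro exI[of _ "M + Suc N"]) auto
    qed
  qed
qed

section \<open>Topology, dense orbits and the words of a level\<close>

abbreviation edge_product where
  "edge_product \<equiv> product_topology (\<lambda>i. discrete_topology (Edg B i)) {1..}"

lemma topspace_path [simp]: "topspace (path_topology B) = X"
  by (auto simp: path_topology_def path_space_def)

lemma cylinder_open:
  assumes "x \<in> (\<Pi>\<^sub>E i\<in>{1..}. Edg B i)"
  shows "openin edge_product {y \<in> (\<Pi>\<^sub>E i\<in>{1..}. Edg B i). agree m x y}"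
proof -
  let ?U = "\<lambda>i. if 1 \<le> i \<and> i \<le> m then {x i} else Edg B i"
  have "{i. ?U i \<noteq> topspace (discrete_topology (Edg B i))} \<subseteq> {..m}" by auto
  then have "finite {i. ?U i \<noteq> topspace (discrete_topology (Edg B i))}" by (rule finite_subset) simp
  then have "openin edge_product (\<Pi>\<^sub>E i\<in>{1..}. ?U i)"
    using assms by (intro product_topology_basis) auto
  also have "(\<Pi>\<^sub>E i\<in>{1..}. ?U i) = {y \<in> (\<Pi>\<^sub>E i\<in>{1..}. Edg B i). agree m x y}"
  proof (intro set_eqI iffI)
    fix y assume y: "y \<in> (\<Pi>\<^sub>E i\<in>{1..}. ?U i)"
    then have yi: "y i \<in> ?U i" if "1 \<le> i" for i using PiE_mem[OF y, of i] that by simp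
    have "y i \<in> Edg B i" if "1 \<le> i" for i using yi[OF that] assms that by (auto split: if_splits)
    moreover have "x i = y i" if "1 \<le> i" "i \<le> m" for i using yi[of i] that by simp
    ultimately show "y \<in> {y \<in> (\<Pi>\<^sub>E i\<in>{1..}. Edg B i). agree m x y}"
      using y by (auto simp: agree_def PiE_iff)
  qed (auto simp: agree_def PiE_iff)
  finally show ?thesis .
qed

lemma open_if_local:
  assumes "S \<subseteq> X" "\<And>x. x \<in> S \<Longrightarrow> \<exists>m. \<forall>y\<in>X. agree m x y \<longrightarrow> y \<in> S"
  shows "openin (path_topology B) S"
proof (subst openin_subopen, intro ballI)
  fix x assume x: "x \<in> S"
  then obtain m where m: "\<forall>y\<in>X. agree m x y \<longrightarrow> y \<in> S" using assms(2) by blast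
  have xP: "x \<in> (\<Pi>\<^sub>E i\<in>{1..}. Edg B i)" using x assms(1) by (auto simp: path_space_def)
  let ?O = "{y \<in> (\<Pi>\<^sub>E i\<in>{1..}. Edg B i). agree m x y} \<inter> X"
  have "openin (path_topology B) ?O"
    unfolding path_topology_def openin_subtopology using cylinder_open[OF xP] by blast
  moreover have "x \<in> ?O" using xP x assms(1) by auto
  moreover have "?O \<subseteq> S" using m by blast
  ultimately show "\<exists>U. openin (path_topology B) U \<and> x \<in> U \<and> U \<subseteq> S" by blast
qed

lemma closed_if_local:
  assumes "S \<subseteq> X" "\<And>x. x \<in> X \<Longrightarrow> x \<notin> S \<Longrightarrow> \<exists>m. \<forall>y\<in>X. agree m x y \<longrightarrow> y \<notin> S"
  shows "closedin (path_topology B) S"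
proof -
  have "openin (path_topology B) (X - S)"
    by (rule open_if_local) (use assms(2) in auto)
  then show ?thesis using assms(1) by (simp add: closedin_def)
qed

lemma continuous_into_discrete:
  assumes "\<And>x. x \<in> X \<Longrightarrow> g x \<in> S" "\<And>x. x \<in> X \<Longrightarrow> \<exists>m. \<forall>y\<in>X. agree m x y \<longrightarrow> g x = g y"
  shows "continuous_map (path_topology B) (discrete_topology S) g"
  unfolding continuous_map_def
proof (intro conjI allI impI)
  fix U assume "openin (discrete_topology S) U"
  show "openin (path_topology B) {x \<in> topspace (path_topology B). g x \<in> U}"
  proof (rule open_if_local)
    fix x assume "x \<in> {x \<in> topspace (path_topology B). g x \<in> U}"
    then have "x \<in> X" "g x \<in> U" by auto
    obtain m where "\<forall>y\<in>X. agree m x y \<longrightarrow> g x = g y" using assms(2)[OF \<open>x \<in> X\<close>] by blast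
    with \<open>g x \<in> U\<close> have "\<forall>y\<in>X. agree m x y \<longrightarrow> y \<in> {x \<in> topspace (path_topology B). g x \<in> U}"
      by (metis (mono_tags, lifting) mem_Collect_eq topspace_path)
    then show "\<exists>m. \<forall>y\<in>X. agree m x y \<longrightarrow> y \<in> {x \<in> topspace (path_topology B). g x \<in> U}" ..
  qed auto
qed (use assms in auto)

lemma compact_path_space: "compact_space (path_topology B)"
proof -
  have "closedin edge_product X"
    unfolding closedin_def
  proof (intro conjI)
    show "X \<subseteq> topspace edge_product" by (auto simp: path_space_def)
    show "openin edge_product (topspace edge_product - X)"
    proof (subst openin_subopen, intro ballI)
      fix x assume x: "x \<in> topspace edge_product - X"
      then have xP: "x \<in> (\<Pi>\<^sub>E i\<in>{1..}. Edg B i)" by simp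
      with x obtain i where i: "1 \<le> i" "rng B (x i) \<noteq> src B (x (Suc i))" by (auto simp: path_space_def)
      let ?O = "{y \<in> (\<Pi>\<^sub>E i\<in>{1..}. Edg B i). agree (Suc i) x y}"
      have "y \<notin> X" if "y \<in> ?O" for y
        using that i by (auto simp: path_space_def agree_def dest!: spec[of _ i])
      then have "?O \<subseteq> topspace edge_product - X" by auto
      moreover have "x \<in> ?O" using xP by simp
      ultimately show "\<exists>U. openin edge_product U \<and> x \<in> U \<and> U \<subseteq> topspace edge_product - X"
        using cylinder_open[OF xP] by blast
    qed
  qed
  moreover have "compact_space edge_product"
    using finite_Edg by (auto simp: compact_space_product_topology compact_space_discrete_topology)
  ultimately have "compactin edge_product X" by (rule closedin_compact_space[rotated])
  then show ?thesis unfolding path_topology_def by (simp add: compact_space_subtopology)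
qed

lemma metrizable_path_space: "metrizable_space (path_topology B)"
proof -
  have "metrizable_space edge_product"
    by (auto simp: metrizable_space_product_topology)
  then show ?thesis unfolding path_topology_def by (rule metrizable_space_subtopology)
qed

text \<open>Only continuity at \<open>x_max\<close> needs an argument. By compactness, paths that begin with many minimal
  edges are close to \<open>x_min\<close>, since otherwise a limit would be a second path of minimal edges.
  Images of paths close to \<open>x_max\<close> begin with many minimal edges.\<close>
lemma T_local:
  assumes x: "x \<in> X"
  shows "\<exists>m. \<forall>y\<in>X. agree m x y \<longrightarrow> agree n (T x) (T y)"
proof (cases "x = x_max B R")
  case False
  then obtain k where k: "\<not> top_floor k x" using x_max_unique[OF x] by blast
  then have k': "\<not> top_floor (max n k) x" by (auto simp: top_floor_def)
  have "agree n (T x) (T y)" if "y \<in> X" "agree (max n k) x y" for y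
    using not_top_floor(4)[OF x k' that] by (rule agree_mono) simp
  then show ?thesis by blast
next
  case True
  \<comment> \<open>a point in all these sets would be a second path of minimal edges\<close>
  define C where "C m = {y \<in> X. bottom m y \<and> \<not> agree n y (x_min B R)}" for m
  have "\<exists>m. C m = {}"
  proof (rule ccontr)
    assume ne: "\<nexists>m. C m = {}"
    have "(\<Inter>m. C m) \<noteq> {}"
    proof (rule compact_space_imp_nest[OF compact_path_space])
      show "closedin (path_topology B) (C m)" for m
      proof (rule closed_if_local)
        fix x assume x: "x \<in> X" "x \<notin> C m"
        have "y \<notin> C m" if "y \<in> X" "agree (max m n) x y" for y
          using x that unfolding C_def bottom_def agree_def by auto
        then show "\<exists>m'. \<forall>y\<in>X. agree m' x y \<longrightarrow> y \<notin> C m" by blast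
      qed (auto simp: C_def)
      show "decseq C" by (rule decseq_SucI) (auto simp: C_def bottom_def)
    qed (use ne in auto)
    then obtain y where "\<And>m. y \<in> C m" by blast
    then have "y \<in> X" "\<And>m. bottom m y" "\<not> agree n y (x_min B R)" by (auto simp: C_def)
    with x_min_unique[of y] show False by auto
  qed
  then obtain m where m: "C m = {}" by blast
  have "agree n (T x) (T y)" if y: "y \<in> X" "agree m x y" for y
  proof -
    have "top_floor m y" using x_max(2)[of m] y(2) True by (auto simp: top_floor_def agree_def)
    then have "bottom m (T y)" using top_floor_bottom y(1) by blast
    then show ?thesis using m T_closed[OF y(1)] True vershik_x_max by (auto simp: C_def agree_sym)
  qed
  then show ?thesis by blast
qed

lemma T_homeomorphism: "homeomorphic_map (path_topology B) (path_topology B) T"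
proof (rule continuous_imp_homeomorphic_map[OF _ compact_path_space])
  have "continuous_map (path_topology B) (discrete_topology (Edg B i)) (\<lambda>x. T x i)" if "1 \<le> i" for i
  proof (rule continuous_into_discrete)
    show "x \<in> X \<Longrightarrow> T x i \<in> Edg B i" for x using path(1)[OF T_closed that] .
    show "\<exists>m. \<forall>y\<in>X. agree m x y \<longrightarrow> T x i = T y i" if "x \<in> X" for x
      using T_local[OF that, of i] \<open>1 \<le> i\<close> by (auto simp: agree_def)
  qed
  moreover have "T \<in> X \<rightarrow> extensional {1..}"
    using T_closed by (auto simp: path_space_def PiE_def)
  ultimately have "continuous_map (path_topology B) edge_product T"
    by (auto simp: continuous_map_componentwise)
  then show "continuous_map (path_topology B) (path_topology B) T"
    using T_closed by (subst (2) path_topology_def) (auto simp: continuous_map_in_subtopology)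
  show "Hausdorff_space (path_topology B)"
    by (rule metrizable_imp_Hausdorff_space[OF metrizable_path_space])
qed (use T_bij in \<open>auto simp: bij_betw_def\<close>)

lemma dynamical: "dynamical_system (path_topology B) T"
  by (simp add: dynamical_system_def compact_path_space metrizable_path_space T_homeomorphism)

abbreviation I where "I \<equiv> int_iterate X T"

lemma I_0 [simp]: "I 0 x = x" by (simp add: int_iterate_def)

lemma I_nat: "I (int n) x = (T ^^ n) x" by (simp add: int_iterate_def)

lemma I_neg: "x \<in> X \<Longrightarrow> I (- int n) x = (T' ^^ n) x \<and> (T' ^^ n) x \<in> X"
proof (induction n)
  case (Suc n)
  have inv: "inv_into X T y = T' y" if "y \<in> X" for y
    using that T_bij by (intro inv_into_f_eq) (auto simp: bij_betw_def T_T' T'_closed)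
  have "I (- int (Suc n)) x = inv_into X T (I (- int n) x)"
    by (cases n) (simp_all add: int_iterate_def nat_add_distrib)
  with Suc inv T'_closed show ?case by simp
qed simp

lemma I_closed: "x \<in> X \<Longrightarrow> I k x \<in> X"
  by (cases k rule: int_cases2) (use I_neg T_funpow_closed I_nat in auto)

lemma I_Suc:
  assumes "x \<in> X"
  shows "I (k + 1) x = T (I k x)"
proof (cases "0 \<le> k")
  case True
  then obtain n where "k = int n" using nonneg_int_cases by blast
  then have "k + 1 = int (Suc n)" by simp
  show ?thesis unfolding \<open>k + 1 = _\<close> unfolding I_nat \<open>k = int n\<close> by simp
next
  case False
  then obtain n where n: "k = - int (Suc n)" by (metis int_cases nonneg_int_cases of_nat_0_le_iff negD linorder_not_le)
  then have k1: "k + 1 = - int n" by simp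
  have "I k x = T' (I (- int n) x)" using I_neg[OF assms, of "Suc n"] I_neg[OF assms, of n] n by simp
  then show ?thesis using k1 T_T' I_closed[OF assms] by simp
qed

lemma I_pred: "x \<in> X \<Longrightarrow> I (k - 1) x = T' (I k x)"
  using I_Suc[of x "k - 1"] T'_T[OF I_closed[of x "k - 1"]] by simp

lemma I_add:
  assumes "x \<in> X"
  shows "I (a + b) x = I a (I b x)"
proof (induction a rule: int_induct[where k = 0])
  case (step1 i)
  have "I (i + 1 + b) x = T (I (i + b) x)" using I_Suc[OF assms, of "i + b"] by (simp add: algebra_simps)
  with step1 show ?case using I_Suc[OF I_closed[OF assms]] by simp
next
  case (step2 i)
  have "I (i - 1 + b) x = T' (I (i + b) x)" using I_pred[OF assms, of "i + b"] by (simp add: algebra_simps)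
  with step2 show ?case using I_pred[OF I_closed[OF assms]] by simp
qed simp

lemma T'_local:
  assumes "x \<in> X"
  shows "\<exists>m. \<forall>y\<in>X. agree m x y \<longrightarrow> agree n (T' x) (T' y)"
  by (rule vershik.T_local[OF vershik_converse assms])

lemma I_local:
  assumes x: "x \<in> X"
  shows "\<exists>m. \<forall>y\<in>X. agree m x y \<longrightarrow> agree n (I k x) (I k y)"
proof (induction k arbitrary: n rule: int_induct[where k = 0])
  case base
  then show ?case by auto
next
  case (step1 i)
  obtain l where "\<forall>y\<in>X. agree l (I i x) y \<longrightarrow> agree n (T (I i x)) (T y)"
    using T_local[OF I_closed[OF x]] by blast
  moreover obtain m where "\<forall>y\<in>X. agree m x y \<longrightarrow> agree l (I i x) (I i y)"
    using step1 by blast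
  ultimately have "\<forall>y\<in>X. agree m x y \<longrightarrow> agree n (I (i + 1) x) (I (i + 1) y)"
    using x by (simp add: I_Suc I_closed)
  then show ?case by blast
next
  case (step2 i)
  obtain l where "\<forall>y\<in>X. agree l (I i x) y \<longrightarrow> agree n (T' (I i x)) (T' y)"
    using T'_local[OF I_closed[OF x]] by blast
  moreover obtain m where "\<forall>y\<in>X. agree m x y \<longrightarrow> agree l (I i x) (I i y)"
    using step2 by blast
  ultimately have "\<forall>y\<in>X. agree m x y \<longrightarrow> agree n (I (i - 1) x) (I (i - 1) y)"
    using x by (simp add: I_pred I_closed)
  then show ?case by blast
qed

text \<open>Both paths climb to the top floor of level \<open>n\<close> without changing their common tail, and there they
  coincide.\<close>
lemma cofinal_same_orbit:
  assumes x: "x \<in> X" and z: "z \<in> X" and eq: "\<And>i. n < i \<Longrightarrow> z i = x i"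
  shows "\<exists>k. z = I k x"
proof -
  obtain N where N: "top_floor n ((T ^^ N) x)" "\<forall>i>n. (T ^^ N) x i = x i"
    using reach_top_floor[OF x] by blast
  obtain M where M: "top_floor n ((T ^^ M) z)" "\<forall>i>n. (T ^^ M) z i = z i"
    using reach_top_floor[OF z] by blast
  have NX: "(T ^^ N) x \<in> X" "(T ^^ M) z \<in> X" using T_funpow_closed x z by auto
  have "vertex ((T ^^ N) x) n = vertex ((T ^^ M) z) n"
    using N(2) M(2) eq by (simp add: vertex_def)
  then have "agree n ((T ^^ N) x) ((T ^^ M) z)"
    using vershik.bottom_unique[OF vershik_converse NX] N(1) M(1) by (simp add: converse_notions)
  then have "(T ^^ N) x = (T ^^ M) z"
    using N(2) M(2) eq by (intro path_eqI[OF NX]) (metis agree_def linorder_not_le)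
  then have "I (- int M) (I (int N) x) = I (- int M) (I (int M) z)" by (simp add: I_nat)
  then have "I (int N - int M) x = z"
    using I_add[OF x, of "- int M" "int N"] I_add[OF z, of "- int M" "int M"] by simp
  then show ?thesis by blast
qed

text \<open>Simplicity allows an initial segment of \<open>y\<close> to be continued so that it runs into the tail of
  \<open>x\<close>. The resulting path is cofinal with \<open>x\<close>, hence on its orbit.\<close>
theorem orbits_dense:
  assumes x: "x \<in> X" and y: "y \<in> X"
  shows "\<exists>k. agree n y (I k x)"
proof -
  obtain m where m: "strict_mono m" "fully_connected (telescoping B m)"
    using proper by (auto simp: properly_ordered_def simple_diagram_def)
  define a b where "a = m n" and "b = m (Suc n)"
  have ab: "n \<le> a" "a < b"
    using m(1) by (auto simp: a_def b_def strict_mono_imp_increasing strict_mono_less)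
  have "\<exists>p\<in>finite_paths B a b. src B (hd p) = vertex y a \<and> rng B (last p) = vertex x b"
    using m(2) path(4)[OF y, of a] path(4)[OF x, of b] unfolding a_def b_def
    by (auto simp: fully_connected_def telescoping_def dest!: spec[of _ "Suc n"])
  then obtain p where p: "p \<in> finite_paths B a b" "src B (hd p) = vertex y a" "rng B (last p) = vertex x b"
    by blast
  have len: "length p = b - a" "p \<noteq> []" using p(1) ab by (auto simp: finite_paths_def)
  define z where "z i = (if i = 0 then undefined else if i \<le> a then y i
    else if i \<le> b then p ! (i - Suc a) else x i)" for i
  have zy: "z i = y i" if "1 \<le> i" "i \<le> a" for i using that by (simp add: z_def)
  have zp: "z (Suc (a + j)) = p ! j" if "j < b - a" for j
  proof -
    have "Suc (a + j) \<le> b" using that by simp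
    then show ?thesis by (simp add: z_def)
  qed
  have zx: "z i = x i" if "b < i" for i using that ab by (simp add: z_def)
  have "z \<in> X"
  proof (rule path_spaceI)
    fix i :: nat assume i: "1 \<le> i"
    consider "i \<le> a" | "a < i" "i \<le> b" | "b < i" by linarith
    then show "z i \<in> Edg B i"
    proof cases
      case 2
      then obtain j where "i = Suc (a + j)" using less_imp_Suc_add by blast
      with 2 show ?thesis using zp[of j] p(1) by (simp add: finite_paths_def)
    qed (use i zy zx path x y in auto)
    consider "i < a" | "i = a" | "a < i" "i < b" | "i = b" | "b < i" by linarith
    then show "rng B (z i) = src B (z (Suc i))"
    proof cases
      case 1
      then show ?thesis using i zy path(3)[OF y i] by (simp add: vertex_def)
    next
      case 2
      then show ?thesis using i zy[OF i] zp[of 0] path(3)[OF y i] ab p(2) len by (simp add: hd_conv_nth)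
    next
      case 3
      then obtain j where "i = Suc (a + j)" using less_imp_Suc_add by blast
      with 3 show ?thesis using zp[of j] zp[of "Suc j"] p(1) by (simp add: finite_paths_def)
    next
      case 4
      have "z b = last p" using zp[of "b - Suc a"] ab len by (simp add: last_conv_nth)
      then show ?thesis using 4 p(3) zx[of "Suc b"] by (simp add: vertex_def)
    next
      case 5
      then show ?thesis using i zx path(3)[OF x i] by (simp add: vertex_def)
    qed
  qed (simp add: z_def)
  then obtain k where "z = I k x" using cofinal_same_orbit[OF x _ zx] by blast
  moreover have "agree n y z" using zy ab by (simp add: agree_def)
  ultimately show ?thesis by blast
qed

definition initial :: "nat \<Rightarrow> (nat \<Rightarrow> 'e) \<Rightarrow> 'e list" where
  "initial n x = map x [1..<Suc n]"

definition row :: "nat \<Rightarrow> (nat \<Rightarrow> 'e) \<Rightarrow> int \<Rightarrow> 'e list" where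
  "row n x k = initial n (I k x)"

definition cuts :: "nat \<Rightarrow> (nat \<Rightarrow> 'e) \<Rightarrow> int set" where
  "cuts n x = {k. bottom n (I k x)}"

definition level_words :: "nat \<Rightarrow> 'e list list set" where
  "level_words n = {segment (row n x) 0 b |x b. x \<in> X \<and> consec (cuts n x) 0 b}"

lemma initial_eq_iff: "initial n x = initial n y \<longleftrightarrow> agree n x y"
  by (auto simp: initial_def agree_def)

lemma take_initial: "i \<le> j \<Longrightarrow> take i (initial j x) = initial i x"
  by (simp add: initial_def take_map take_upt del: upt_Suc)

text \<open>Two paths on the bottom floor of the same tower move up together, by \<open>not_top_floor\<close>, and reach its
  top at the same time. So the word read between two cuts depends on the vertex only.\<close>
lemma tower_agree:
  assumes x: "x \<in> X" "consec (cuts n x) 0 b" and y: "y \<in> X" "consec (cuts n y) 0 c"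
    and v: "vertex x n = vertex y n"
  shows "int t < b \<Longrightarrow> int t < c \<Longrightarrow> agree n (I (int t) x) (I (int t) y)"
proof (induction t)
  case 0
  then show ?case using x y v by (auto simp: consec_def cuts_def intro: bottom_unique)
next
  case (Suc t)
  have s: "I (int (Suc t)) z = T (I (int t) z)" if "z \<in> X" for z
    using I_Suc[OF that, of "int t"] by (simp add: algebra_simps)
  have "int (Suc t) \<notin> cuts n x" using x(2) Suc.prems(1) unfolding consec_def by force
  then have "\<not> top_floor n (I (int t) x)"
    using top_floor_bottom[OF I_closed[OF x(1)]] s[OF x(1)] by (auto simp: cuts_def)
  then have "agree n (T (I (int t) x)) (T (I (int t) y))"
    using Suc by (intro not_top_floor(4)) (auto simp: I_closed x y)
  then show ?case by (simp only: s x(1) y(1))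
qed

lemma tower_height:
  assumes x: "x \<in> X" "consec (cuts n x) 0 b" and y: "y \<in> X" "consec (cuts n y) 0 c"
    and v: "vertex x n = vertex y n"
  shows "\<not> b < c"
proof
  assume bc: "b < c"
  have "0 < b" using x(2) by (simp add: consec_def)
  then have t: "int (nat (b - 1)) = b - 1" by simp
  have "T (I (b - 1) x) = I b x" "T (I (b - 1) y) = I b y" using I_Suc x(1) y(1) by (metis diff_add_cancel)+
  moreover have "bottom n (I b x)" using x(2) by (simp add: consec_def cuts_def)
  ultimately have "top_floor n (I (b - 1) x)"
    using not_top_floor(1)[OF I_closed[OF x(1)]] by metis
  moreover have "agree n (I (b - 1) x) (I (b - 1) y)"
    using tower_agree[OF assms, of "nat (b - 1)"] bc t by simp
  ultimately have "top_floor n (I (b - 1) y)" by (auto simp: top_floor_def agree_def)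
  then have "bottom n (I b y)"
    using top_floor_bottom[OF I_closed[OF y(1)]] \<open>T (I (b - 1) y) = I b y\<close> by metis
  then show False using y(2) bc \<open>0 < b\<close> unfolding consec_def cuts_def by force
qed

lemma tower_word_unique:
  assumes "x \<in> X" "consec (cuts n x) 0 b" "y \<in> X" "consec (cuts n y) 0 c" "vertex x n = vertex y n"
  shows "segment (row n x) 0 b = segment (row n y) 0 c"
proof -
  have "b = c" using tower_height[OF assms] tower_height[OF assms(3,4,1,2)] assms(5) by simp
  moreover have "row n x i = row n y i" if "0 \<le> i" "i < b" for i
    using tower_agree[OF assms, of "nat i"] that \<open>b = c\<close> by (simp add: row_def initial_eq_iff)
  ultimately show ?thesis by (simp add: segment_def)
qed

lemma level_words: "finite (level_words n)" "[] \<notin> level_words n" "card (level_words n) \<le> card (Vtx B n)"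
proof -
  define P where "P v w \<longleftrightarrow> (\<exists>x b. w = segment (row n x) 0 b \<and> x \<in> X \<and> consec (cuts n x) 0 b \<and> vertex x n = v)" for v w
  define f where "f v = (SOME w. P v w)" for v
  have "level_words n \<subseteq> f ` Vtx B n"
  proof
    fix w assume "w \<in> level_words n"
    then obtain x b where w: "w = segment (row n x) 0 b" "x \<in> X" "consec (cuts n x) 0 b"
      by (auto simp: level_words_def)
    then have "P (vertex x n) w" by (auto simp: P_def)
    then have "P (vertex x n) (f (vertex x n))" unfolding f_def by (rule someI)
    then obtain y c where "f (vertex x n) = segment (row n y) 0 c" "y \<in> X" "consec (cuts n y) 0 c"
        "vertex y n = vertex x n" by (auto simp: P_def)
    then have "f (vertex x n) = w" using tower_word_unique w by metis
    then show "w \<in> f ` Vtx B n" using path(4)[OF w(2)] by blast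
  qed
  then show "finite (level_words n)" "card (level_words n) \<le> card (Vtx B n)"
    using finite_Vtx[of n] by (auto intro: finite_subset surj_card_le)
  show "[] \<notin> level_words n"
  proof
    assume "[] \<in> level_words n"
    then have "\<exists>x b. segment (row n x) 0 b = [] \<and> 0 < b"
      unfolding level_words_def consec_def by auto metis
    then obtain x b where "segment (row n x) 0 b = []" "0 < b" by blast
    then show False using length_segment[of "row n x" 0 b] by simp
  qed
qed

lemma row_shift: "x \<in> X \<Longrightarrow> row n (I a x) k = row n x (a + k)"
  by (simp add: row_def I_add[of x k a, symmetric] add.commute)

lemma cutting_row:
  assumes x: "x \<in> X"
  shows "cutting (level_words n) (row n x) (cuts n x)"
  unfolding cutting_def
proof (intro conjI allI impI)
  fix a
  obtain N where N: "top_floor n ((T ^^ N) (I a x))"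
    using reach_top_floor[OF I_closed[OF x]] by blast
  then have "bottom n (T (I (int N) (I a x)))"
    using top_floor_bottom I_closed x by (simp add: I_nat[symmetric])
  moreover have "I (int N + a + 1) x = T (I (int N) (I a x))"
    using I_Suc[OF x, of "int N + a"] I_add[OF x, of "int N" a] by simp
  ultimately have "bottom n (I (int N + a + 1) x)" by simp
  then show "\<exists>k\<in>cuts n x. a < k" by (intro bexI[of _ "int N + a + 1"]) (auto simp: cuts_def)
next
  fix a
  have "I (a - 1) x \<in> X" using I_closed[OF x] .
  then obtain N where "bottom n ((T' ^^ N) (I (a - 1) x))"
    using vershik.reach_top_floor[OF vershik_converse, of "I (a - 1) x" n] by (auto simp: converse_notions)
  then have "bottom n (I (- int N + (a - 1)) x)"
    using I_neg[OF I_closed[OF x]] I_add[OF x, of "- int N" "a - 1"] by simp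
  then show "\<exists>k\<in>cuts n x. k < a" by (intro bexI[of _ "- int N + (a - 1)"]) (auto simp: cuts_def)
next
  fix a b assume ab: "consec (cuts n x) a b"
  have cut: "k \<in> cuts n (I a x) \<longleftrightarrow> a + k \<in> cuts n x" for k
    using I_add[OF x, of k a] by (simp add: cuts_def add.commute)
  have "consec (cuts n (I a x)) 0 (b - a)"
    using ab unfolding consec_def by (auto simp: cut dest!: bspec[of _ _ "a + k" for k])
  then have "segment (row n (I a x)) 0 (b - a) \<in> level_words n"
    using I_closed[OF x] by (auto simp: level_words_def)
  moreover have "segment (row n (I a x)) 0 (b - a) = segment (row n x) a b"
    using ab by (subst segment_eq_iff) (auto simp: consec_def row_shift[OF x])
  ultimately show "segment (row n x) a b \<in> level_words n" by simp
qed

theorem aperiodic_row_determines_point: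
  assumes L: "\<And>n. card (Vtx B n) \<le> L"
    and aper: "\<And>i x. i0 \<le> i \<Longrightarrow> x \<in> X \<Longrightarrow> \<not> periodic (row i x)"
  shows "\<exists>i. \<forall>x\<in>X. \<forall>y\<in>X. row i x = row i y \<longrightarrow> x = y"
proof -
  have "\<exists>i. \<forall>x\<in>X. \<forall>y\<in>X. row i x = row i y \<longrightarrow> (\<forall>j. row j x = row j y)"
  proof (rule some_row_determines_all[where pr = take and W = level_words and L = L])
    show "row i x = take i \<circ> row j x" if "i \<le> j" for i j x
      using that by (auto simp: row_def take_initial)
    show "take i (take j a) = take i a" if "i \<le> j" for i j and a :: "'e list"
      using that by (simp add: min_def)
    show "card (level_words j) \<le> L" for j using level_words(3) L le_trans by blast
    show "\<exists>K. cutting (level_words j) (row j x) K" if "x \<in> X" for j x using cutting_row[OF that] by blast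
    show "\<not> periodic (row i x)" if "i0 \<le> i" "x \<in> X" for i x using aper that .
  qed (rule level_words)+
  then obtain i where i: "\<forall>x\<in>X. \<forall>y\<in>X. row i x = row i y \<longrightarrow> (\<forall>j. row j x = row j y)" by blast
  have "x = y" if "x \<in> X" "y \<in> X" "row i x = row i y" for x y
  proof (rule path_eq_if_agree[OF that(1,2)])
    fix n
    have "row n x 0 = row n y 0" using i[rule_format, OF that, of n] by (rule fun_cong)
    then show "agree n x y" by (simp add: row_def initial_eq_iff)
  qed
  then show ?thesis by blast
qed

section \<open>Expansiveness and the odometer\<close>

text \<open>The cells of equal initial segments form an open cover. A Lebesgue number of it is a lower bound for
  the distance at any time when the \<open>n\<close>-th rows of two paths differ.\<close>
theorem expansive_if_row_determines_point:
  assumes "\<And>x y. x \<in> X \<Longrightarrow> y \<in> X \<Longrightarrow> row n x = row n y \<Longrightarrow> x = y"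
  shows "expansive_system (path_topology B) T"
proof -
  obtain M d where d: "Metric_space M d" "path_topology B = Metric_space.mtopology M d"
    using metrizable_path_space by (auto simp: metrizable_space_def)
  then have "M = X" using Metric_space.topspace_mtopology[OF d(1)] by (metis topspace_path)
  interpret Metric_space X d using d(1) \<open>M = X\<close> by simp
  have top: "path_topology B = mtopology" using d(2) \<open>M = X\<close> by simp
  define cell where "cell w = {x \<in> X. initial n x = w}" for w
  have "openin mtopology (cell w)" for w
    unfolding top[symmetric]
  proof (rule open_if_local)
    fix x assume "x \<in> cell w"
    then have "\<forall>y\<in>X. agree n x y \<longrightarrow> y \<in> cell w"
      by (simp add: cell_def flip: initial_eq_iff)
    then show "\<exists>m. \<forall>y\<in>X. agree m x y \<longrightarrow> y \<in> cell w" ..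
  qed (auto simp: cell_def)
  moreover have "compactin mtopology X"
    using compact_path_space unfolding top compact_space_def by simp
  ultimately obtain e where e: "e > 0" "\<forall>x\<in>X. \<exists>U\<in>range cell. mball x e \<subseteq> U"
    using lebesgue_number[of X "range cell"] by (auto simp: cell_def)
  have far: "e \<le> d x y" if "x \<in> X" "y \<in> X" "initial n x \<noteq> initial n y" for x y
  proof (rule ccontr)
    note xy = that
    assume "\<not> e \<le> d x y"
    then have "x \<in> mball x e" "y \<in> mball x e" using that e by auto
    moreover obtain U where "U \<in> range cell" "mball x e \<subseteq> U" using e(2) xy(1) by blast
    ultimately have "\<exists>w. x \<in> cell w \<and> y \<in> cell w" by blast
    then show False using that(3) by (auto simp: cell_def)
  qed
  have "(SUP k. ereal (d (I k x) (I k y))) > ereal (e / 2)" if xy: "x \<in> X" "y \<in> X" "x \<noteq> y" for x y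
  proof -
    obtain k where "row n x k \<noteq> row n y k" using assms xy by blast
    then have "e \<le> d (I k x) (I k y)" using far I_closed xy by (simp add: row_def)
    then have "ereal (e / 2) < ereal (d (I k x) (I k y))" using e(1) by simp
    then show ?thesis by (rule less_SUP_iff[THEN iffD2, OF bexI]) simp
  qed
  then show ?thesis
    unfolding expansive_system_def topspace_path using dynamical Metric_space_axioms top e(1)
    by (intro conjI exI[of _ d] exI[of _ "e / 2"]) auto
qed

text \<open>Density of orbits carries a period of one row to the rows of all other paths.\<close>
lemma period_transfer:
  assumes x: "x \<in> X" and p: "\<And>k. agree n (I (k + p) x) (I k x)" and y: "y \<in> X"
  shows "agree n (I p y) y"
proof -
  obtain m where m: "\<forall>z\<in>X. agree m y z \<longrightarrow> agree n (I p y) (I p z)" using I_local[OF y] by blast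
  obtain k where k: "agree (max m n) y (I k x)" using orbits_dense[OF x y] by blast
  have "agree n (I p y) (I p (I k x))" using m agree_mono[OF k] I_closed[OF x] by simp
  also have "I p (I k x) = I (k + p) x" using I_add[OF x, of p k] by (simp add: add.commute)
  finally have "agree n (I p y) (I k x)" using p agree_trans by blast
  moreover have "agree n (I k x) y" using agree_mono[OF agree_sym[OF k]] by simp
  ultimately show ?thesis by (rule agree_trans)
qed

end

locale periodic_vershik = vershik B R
  for B :: "('v, 'e) bratteli_data" and R :: "'e rel" +
  assumes infinite_paths: "infinite X"
    and all_periodic: "\<And>n. \<exists>p>0. \<forall>y\<in>X. agree n (I (int p) y) y"
begin

definition period :: "nat \<Rightarrow> nat" where
  "period n = (LEAST p. p > 0 \<and> (\<forall>y\<in>X. agree n (I (int p) y) y))"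

lemma period: "period n > 0" "y \<in> X \<Longrightarrow> agree n (I (int (period n)) y) y"
proof -
  have "period n > 0 \<and> (\<forall>y\<in>X. agree n (I (int (period n)) y) y)"
    unfolding period_def by (rule LeastI_ex) (use all_periodic in blast)
  then show "period n > 0" "y \<in> X \<Longrightarrow> agree n (I (int (period n)) y) y" by auto
qed

lemma period_multiple:
  assumes y: "y \<in> X"
  shows "agree n (I (int (period n) * q) y) y"
proof (induction q rule: int_induct[where k = 0])
  case (step1 i)
  have "I (int (period n) * (i + 1)) y = I (int (period n)) (I (int (period n) * i) y)"
    using I_add[OF y, of "int (period n)" "int (period n) * i"] by (simp add: algebra_simps)
  then show ?case using period(2)[OF I_closed[OF y]] step1 agree_trans by metis
next
  case (step2 i)
  have "I (int (period n) * i) y = I (int (period n)) (I (int (period n) * (i - 1)) y)"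
    using I_add[OF y, of "int (period n)" "int (period n) * (i - 1)"] by (simp add: algebra_simps)
  then show ?case using period(2)[OF I_closed[OF y]] step2 agree_trans agree_sym by metis
qed simp

lemma period_cong:
  assumes y: "y \<in> X" and ab: "a mod int (period n) = b mod int (period n)"
  shows "agree n (I a y) (I b y)"
proof -
  obtain q where "a = b + int (period n) * q" using ab by (metis mod_eqE add.commute add_diff_cancel_left' diff_add_cancel mult.commute)
  then have "I a y = I (int (period n) * q) (I b y)" using I_add[OF y, of "int (period n) * q" b]
    by (simp add: add.commute)
  then show ?thesis using period_multiple[OF I_closed[OF y]] by simp
qed

lemma period_dvd:
  assumes "\<And>y. y \<in> X \<Longrightarrow> agree n (I r y) y"
  shows "int (period n) dvd r"
proof -
  define s where "s = r mod int (period n)"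
  have s: "0 \<le> s" "s < int (period n)" using period(1) by (auto simp: s_def)
  have "agree n (I s y) y" if "y \<in> X" for y
    using agree_trans[OF period_cong[OF that, of s n r] assms[OF that]] by (simp add: s_def)
  then have "nat s > 0 \<longrightarrow> period n \<le> nat s"
    unfolding period_def using s by (intro impI Least_le) auto
  then have "s = 0" using s by auto
  then show ?thesis by (auto simp: s_def)
qed

text \<open>A period at level \<open>j\<close> is also one at each lower level, where it is a multiple of the least.\<close>
lemma period_dvd_mono: "i \<le> j \<Longrightarrow> period i dvd period j"
  using period_dvd[of i "int (period j)"] agree_mono[OF period(2)] by simp

text \<open>A periodic row is determined by a finite window, and by continuity a finite window is determined by an
  initial segment of the path.\<close>
lemma rows_local:
  assumes y: "y \<in> X"
  shows "\<exists>m. \<forall>z\<in>X. agree m y z \<longrightarrow> (\<forall>t. agree n (I t y) (I t z))"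
proof -
  have "\<exists>m. \<forall>z\<in>X. agree m y z \<longrightarrow> agree n (I t y) (I t z)" for t using I_local[OF y] .
  then obtain m where m: "\<And>t z. z \<in> X \<Longrightarrow> agree (m t) y z \<Longrightarrow> agree n (I t y) (I t z)" by metis
  \<comment> \<open>one modulus for all times within a period\<close>
  define l where "l = Max (m ` {0..int (period n)})"
  have "agree n (I t y) (I t z)" if z: "z \<in> X" "agree l y z" for z t
  proof -
    define s where "s = t mod int (period n)"
    have "s \<in> {0..int (period n)}" using period(1)[of n] by (auto simp: s_def intro: less_imp_le)
    then have "m s \<le> l" unfolding l_def by (intro Max_ge) auto
    then have "agree n (I s y) (I s z)" using m[OF z(1)] agree_mono[OF z(2)] by blast
    moreover have "agree n (I t y) (I s y)" "agree n (I s z) (I t z)"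
      using period_cong[OF y, of t n s] period_cong[OF z(1), of s n t] by (simp_all add: s_def)
    ultimately show ?thesis using agree_trans by blast
  qed
  then show ?thesis by blast
qed

text \<open>If the periods were eventually equal to some \<open>p\<close>, then every path would be approximated to
  every precision by one of \<open>p\<close> points of a fixed orbit, so the path space would be finite.\<close>
lemma period_unbounded: "\<exists>j>i. period i < period j"
proof (rule ccontr)
  assume neg: "\<not> ?thesis"
  define p where "p = period i"
  have p: "period j = p" if "i \<le> j" for j
  proof -
    have "period i dvd period j" by (rule period_dvd_mono[OF that])
    moreover have "period j \<le> period i" using neg that by (metis le_neq_implies_less linorder_not_le order_refl)
    ultimately show ?thesis using period(1)[of j] unfolding p_def by (metis dvd_imp_le le_antisym)
  qed
  define x where "x = x_min B R"
  have x: "x \<in> X" by (simp add: x_def x_min)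
  have "y \<in> (\<lambda>k. I (int k) x) ` {..<p}" if y: "y \<in> X" for y
  proof (rule ccontr)
    assume "y \<notin> (\<lambda>k. I (int k) x) ` {..<p}"
    then have "\<exists>n. \<not> agree n y (I (int k) x)" if "k < p" for k
      using path_eq_if_agree[OF y I_closed[OF x]] that by blast
    then obtain n where n: "\<And>k. k < p \<Longrightarrow> \<not> agree (n k) y (I (int k) x)" by metis
    define l where "l = Max (insert i (n ` {..<p}))"
    have l: "i \<le> l" "\<And>k. k < p \<Longrightarrow> n k \<le> l" unfolding l_def by (auto intro: Max_ge)
    obtain k where k: "agree l y (I k x)" using orbits_dense[OF x y] by blast
    define s where "s = nat (k mod int p)"
    have ppos: "p > 0" using period(1) by (simp add: p_def)
    then have s: "s < p" "int s = k mod int p" by (auto simp: s_def nat_less_iff)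
    have "agree l (I k x) (I (int s) x)"
      by (rule period_cong[OF x]) (simp add: p[OF l(1)] s)
    with k have "agree l y (I (int s) x)" by (rule agree_trans)
    then show False using n[OF s(1)] l(2)[OF s(1)] agree_mono by blast
  qed
  then have "X \<subseteq> (\<lambda>k. I (int k) x) ` {..<p}" by blast
  then show False using infinite_paths finite_subset by blast
qed

text \<open>An odometer base has to increase strictly, so levels with repeated periods are skipped.\<close>
definition level :: "nat \<Rightarrow> nat" where
  "level = rec_nat 0 (\<lambda>_ i. SOME j. j > i \<and> period i < period j)"

definition base :: "nat \<Rightarrow> nat" where "base k = period (level k)"

lemma level: "level 0 = 0" "level k < level (Suc k)" "base k < base (Suc k)"
proof -
  have "level (Suc k) = (SOME j. j > level k \<and> period (level k) < period j)"
    by (simp add: level_def)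
  moreover have "\<exists>j. j > level k \<and> period (level k) < period j" using period_unbounded by blast
  ultimately have "level (Suc k) > level k \<and> period (level k) < period (level (Suc k))"
    by (metis (mono_tags, lifting) someI_ex)
  then show "level k < level (Suc k)" "base k < base (Suc k)" by (auto simp: base_def)
  show "level 0 = 0" by (simp add: level_def)
qed

lemma level_mono: "i \<le> j \<Longrightarrow> level i \<le> level j"
  using level(2) by (simp add: strict_mono_less_eq strict_monoI_Suc)

lemma le_level: "k \<le> level k"
  using level(2) by (intro strict_mono_imp_increasing strict_monoI_Suc)

lemma base_pos: "base k > 0" by (simp add: base_def period)

lemma base_dvd: "i \<le> j \<Longrightarrow> base i dvd base j"
  unfolding base_def by (intro period_dvd_mono level_mono)

lemma base_0: "base 0 = 1"
proof -
  have "int (base 0) dvd 1"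
    unfolding base_def level(1) by (rule period_dvd) (simp add: agree_def)
  then show ?thesis by simp
qed

lemma odometer_base: "odometer_base base"
  unfolding odometer_base_def
proof (intro conjI allI impI)
  fix i :: nat assume i: "1 \<le> i"
  show dvd: "base (i - 1) dvd base i" by (rule base_dvd) simp
  have "base (i - 1) < base i" using level(3)[of "i - 1"] i by simp
  moreover obtain q where "base i = base (i - 1) * q" using dvd by blast
  ultimately have "2 \<le> q" using base_pos[of "i - 1"] by (cases q; cases "q - 1") auto
  then show "2 \<le> base i div base (i - 1)" using \<open>base i = _\<close> base_pos by simp
qed (rule base_0)

lemma base_mult: "base (Suc k) = base k * (base (Suc k) div base k)"
  using base_dvd[of k "Suc k"] by simp

abbreviation origin where "origin \<equiv> x_min B R"

lemma origin: "origin \<in> X" by (rule x_min)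

text \<open>Row \<open>level k\<close> of \<open>y\<close> is that of the reference path \<open>origin\<close> shifted by \<open>c\<close>. This determines \<open>c\<close>
  modulo \<open>base k\<close>, and these residues are the coordinates of \<open>y\<close> in the inverse limit of the cyclic
  groups.\<close>
definition has_phase :: "nat \<Rightarrow> (nat \<Rightarrow> 'e) \<Rightarrow> int \<Rightarrow> bool" where
  "has_phase k y c \<longleftrightarrow> (\<forall>t. agree (level k) (I t y) (I (t + c) origin))"

definition phase :: "nat \<Rightarrow> (nat \<Rightarrow> 'e) \<Rightarrow> nat" where
  "phase k y = (THE c. c < base k \<and> has_phase k y (int c))"

lemma has_phase_exists:
  assumes y: "y \<in> X"
  shows "\<exists>c. has_phase k y c"
proof -
  obtain m where m: "\<forall>z\<in>X. agree m y z \<longrightarrow> (\<forall>t. agree (level k) (I t y) (I t z))"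
    using rows_local[OF y] by blast
  obtain c where c: "agree m y (I c origin)" using orbits_dense[OF origin y] by blast
  have "has_phase k y c"
    using m c I_closed[OF origin] I_add[OF origin] by (simp add: has_phase_def)
  then show ?thesis ..
qed

lemma has_phase_unique:
  assumes "y \<in> X" "has_phase k y a" "has_phase k y b"
  shows "a mod int (base k) = b mod int (base k)"
proof -
  have "agree (level k) (I (t + (a - b)) origin) (I t origin)" for t
  proof -
    have "agree (level k) (I (t - b) y) (I (t - b + a) origin)" "agree (level k) (I (t - b) y) (I (t - b + b) origin)"
      by (rule assms(2,3)[unfolded has_phase_def, rule_format])+
    then have "agree (level k) (I (t - b + a) origin) (I (t - b + b) origin)"
      by (rule agree_trans[OF agree_sym])
    then have "agree (level k) (I (t - b + a) origin) (I t origin)" by simp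
    then show ?thesis by (simp add: algebra_simps)
  qed
  then have "int (base k) dvd a - b"
    unfolding base_def using period_transfer[OF origin] by (intro period_dvd) blast
  then show ?thesis by (simp add: mod_eq_dvd_iff)
qed

lemma has_phase_cong:
  assumes "has_phase k y a" "a mod int (base k) = b mod int (base k)"
  shows "has_phase k y b"
  unfolding has_phase_def
proof
  fix t
  have "(t + a) mod int (base k) = (t + b) mod int (base k)" using assms(2) by (rule mod_add_cong[OF refl])
  then have "agree (level k) (I (t + a) origin) (I (t + b) origin)"
    unfolding base_def by (rule period_cong[OF origin])
  then show "agree (level k) (I t y) (I (t + b) origin)"
    using assms(1) agree_trans unfolding has_phase_def by blast
qed

lemma phase_eqI:
  assumes "y \<in> X" "has_phase k y a"
  shows "int (phase k y) = a mod int (base k)"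
proof -
  have "phase k y = nat (a mod int (base k))"
    unfolding phase_def
  proof (rule the_equality)
    show "nat (a mod int (base k)) < base k \<and> has_phase k y (int (nat (a mod int (base k))))"
      using has_phase_cong[OF assms(2), of "a mod int (base k)"] base_pos[of k] by (auto simp: nat_less_iff)
    fix c assume c: "c < base k \<and> has_phase k y (int c)"
    then have "int c mod int (base k) = a mod int (base k)" using has_phase_unique assms by blast
    with c show "c = nat (a mod int (base k))" by simp
  qed
  then show ?thesis using base_pos[of k] by simp
qed

lemma phase:
  assumes "y \<in> X"
  shows "phase k y < base k" "has_phase k y (int (phase k y))"
proof -
  obtain a where a: "has_phase k y a" using has_phase_exists[OF assms] by blast
  note eq = phase_eqI[OF assms a]
  show "phase k y < base k" using eq base_pos[of k] by (metis of_nat_0_less_iff of_nat_less_iff pos_mod_bound)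
  show "has_phase k y (int (phase k y))" by (rule has_phase_cong[OF a]) (simp add: eq)
qed

lemma phase_T:
  assumes y: "y \<in> X"
  shows "phase k (T y) = (phase k y + 1) mod base k"
proof -
  have IT: "I t (T y) = I (t + 1) y" for t
    using I_add[OF y, of t 1] I_Suc[OF y, of 0] by simp
  then have "has_phase k (T y) (int (phase k y) + 1)"
    unfolding has_phase_def
  proof (intro allI)
    fix t
    have "agree (level k) (I (t + 1) y) (I (t + 1 + int (phase k y)) origin)"
      by (rule phase(2)[OF y, of k, unfolded has_phase_def, rule_format])
    moreover have "t + (int (phase k y) + 1) = t + 1 + int (phase k y)" by simp
    ultimately show "agree (level k) (I t (T y)) (I (t + (int (phase k y) + 1)) origin)"
      by (simp only: IT)
  qed
  then have "int (phase k (T y)) = (int (phase k y) + 1) mod int (base k)"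
    by (rule phase_eqI[OF T_closed[OF y]])
  also have "\<dots> = int ((phase k y + 1) mod base k)" by (simp add: of_nat_mod add.commute)
  finally show ?thesis by (simp only: of_nat_eq_iff)
qed

lemma has_phase_mono: "has_phase j y a \<Longrightarrow> i \<le> j \<Longrightarrow> has_phase i y a"
  unfolding has_phase_def using agree_mono level_mono by blast

lemma phase_mod:
  assumes "y \<in> X"
  shows "phase (Suc k) y mod base k = phase k y"
  using phase_eqI[OF assms has_phase_mono[OF phase(2)[OF assms, of "Suc k"], of k]]
  by (metis le_SucI le_refl of_nat_eq_iff of_nat_mod)

lemma phase_local:
  assumes y: "y \<in> X"
  shows "\<exists>m. \<forall>z\<in>X. agree m y z \<longrightarrow> phase k y = phase k z"
proof -
  obtain m where m: "\<forall>z\<in>X. agree m y z \<longrightarrow> (\<forall>t. agree (level k) (I t y) (I t z))"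
    using rows_local[OF y] by blast
  have "phase k y = phase k z" if z: "z \<in> X" "agree m y z" for z
  proof -
    have "has_phase k y (int (phase k z))"
      using phase(2)[OF z(1), of k] m z agree_trans unfolding has_phase_def by blast
    then have "int (phase k y) = int (phase k z) mod int (base k)" by (rule phase_eqI[OF y])
    then show ?thesis using phase(1)[OF z(1), of k] by simp
  qed
  then show ?thesis by blast
qed

definition digits :: "(nat \<Rightarrow> 'e) \<Rightarrow> nat \<Rightarrow> nat" where
  "digits y = (\<lambda>i\<in>{1..}. phase i y div base (i - 1))"

lemma phase_Suc:
  assumes "y \<in> X"
  shows "phase (Suc k) y = base k * digits y (Suc k) + phase k y"
  using phase_mod[OF assms, of k] mult_div_mod_eq[of "base k" "phase (Suc k) y"]
  by (simp add: digits_def)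

lemma phase_Suc_div:
  assumes "y \<in> X"
  shows "(phase (Suc k) y + 1) div base k = digits y (Suc k) + (phase k y + 1) div base k"
proof -
  have "phase (Suc k) y + 1 = (phase k y + 1) + digits y (Suc k) * base k"
    using phase_Suc[OF assms] by simp
  then show ?thesis using base_pos[of k] by (simp only: div_mult_self1 neq0_conv add.commute)
qed

lemma digits_range:
  assumes "y \<in> X"
  shows "digits y \<in> (\<Pi>\<^sub>E i\<in>{1..}. {..<base i div base (i - 1)})"
proof (rule PiE_I)
  fix i :: nat assume "i \<in> {1..}"
  then obtain k where k: "i = Suc k" by (cases i) auto
  have "phase (Suc k) y < base k * (base (Suc k) div base k)"
    using phase(1)[OF assms, of "Suc k"] base_mult[of k] by simp
  then show "digits y i \<in> {..<base i div base (i - 1)}"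
    unfolding k digits_def by (simp add: less_mult_imp_div_less mult.commute)
qed (auto simp: digits_def)

text \<open>Adding 1 carries into a digit exactly when the phase below it is maximal. Counting the 1 added to
  the first digit as an incoming carry, this is uniform in \<open>k\<close>, as the phase modulo \<open>base 0 = 1\<close> is 0.\<close>
lemma carry:
  assumes y: "y \<in> X"
  shows "odometer_carry base (digits y) odometer_one (Suc k) + odometer_one (Suc k) = (phase k y + 1) div base k"
proof (induction k)
  case 0
  have "phase 0 y = 0" using phase(1)[OF y, of 0] base_0 by simp
  then show ?case by (simp add: odometer_one_def base_0)
next
  case (Suc k)
  have "(phase (Suc k) y + 1) div base (Suc k) = (phase (Suc k) y + 1) div base k div (base (Suc k) div base k)"
    using base_mult[of k] by (metis div_mult2_eq)
  also have "(phase (Suc k) y + 1) div base k = digits y (Suc k) + (phase k y + 1) div base k"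
    using phase_Suc_div[OF y] .
  finally have "(phase (Suc k) y + 1) div base (Suc k)
      = (digits y (Suc k) + (odometer_one (Suc k) + odometer_carry base (digits y) odometer_one (Suc k)))
        div (base (Suc k) div base k)"
    using Suc by (simp only: add.commute)
  moreover have "odometer_one (Suc (Suc k)) = 0" by (simp add: odometer_one_def)
  ultimately show ?case by (simp only: odometer_carry.simps add.assoc add_0_right)
qed

lemma digits_T:
  assumes y: "y \<in> X"
  shows "digits (T y) = odometer_add base (digits y) odometer_one"
proof
  fix i
  show "digits (T y) i = odometer_add base (digits y) odometer_one i"
  proof (cases i)
    case 0
    then show ?thesis by (simp add: digits_def odometer_add_def)
  next
    case (Suc k)
    let ?q = "base (Suc k) div base k"
    have "digits (T y) (Suc k) = ((phase (Suc k) y + 1) mod (base k * ?q)) div base k"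
      using base_mult[of k] by (simp add: digits_def phase_T[OF y])
    also have "\<dots> = ((phase (Suc k) y + 1) div base k) mod ?q"
      using base_pos[of k] by (simp add: mod_mult2_eq)
    also have "(phase (Suc k) y + 1) div base k = digits y (Suc k) + (phase k y + 1) div base k"
      using phase_Suc_div[OF y] .
    also have "\<dots> = digits y (Suc k) + odometer_one (Suc k) + odometer_carry base (digits y) odometer_one (Suc k)"
      using carry[OF y, of k] by simp
    finally show ?thesis using Suc by (simp add: odometer_add_def)
  qed
qed

lemma digits_inj: "inj_on digits X"
proof (rule inj_onI)
  fix y z assume yz: "y \<in> X" "z \<in> X" "digits y = digits z"
  have ph: "phase k y = phase k z" for k
  proof (induction k)
    case 0
    then show ?case using phase(1)[OF yz(1), of 0] phase(1)[OF yz(2), of 0] base_0 by simp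
  next
    case (Suc k)
    then show ?case using phase_Suc yz by simp
  qed
  show "y = z"
  proof (rule path_eq_if_agree[OF yz(1,2)])
    fix n
    have "agree (level n) y (I (int (phase n z)) origin)"
      "agree (level n) z (I (int (phase n z)) origin)"
      using phase(2)[OF yz(1), of n, unfolded has_phase_def, rule_format, of 0]
        phase(2)[OF yz(2), of n, unfolded has_phase_def, rule_format, of 0] by (simp_all add: ph)
    then have "agree (level n) y z" by (rule agree_trans[OF _ agree_sym])
    then show "agree n y z" using agree_mono le_level by blast
  qed
qed

text \<open>The digits prescribe compatible phases \<open>c k\<close>. The points of the orbit of \<open>origin\<close> at times \<open>c k\<close>
  agree on longer and longer initial segments, so they converge to a path, and row \<open>level k\<close> of the
  limit has phase \<open>c k\<close> because it depends only on an initial segment.\<close>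
lemma digits_surj:
  assumes a: "a \<in> (\<Pi>\<^sub>E i\<in>{1..}. {..<base i div base (i - 1)})"
  shows "\<exists>y\<in>X. digits y = a"
proof -
  define c where "c = rec_nat 0 (\<lambda>k s. base k * a (Suc k) + s)"
  have c0: "c 0 = 0" and cs: "c (Suc k) = base k * a (Suc k) + c k" for k by (auto simp: c_def)
  have as: "a (Suc k) < base (Suc k) div base k" for k using PiE_mem[OF a, of "Suc k"] by simp
  have cb: "c k < base k" for k
  proof (induction k)
    case (Suc k)
    have "c (Suc k) < base k * (a (Suc k) + 1)" using Suc by (simp add: cs)
    also have "\<dots> \<le> base k * (base (Suc k) div base k)" using as[of k] by (intro mult_le_mono2) simp
    finally show ?case using base_mult[of k] by simp
  qed (simp add: c0 base_0)
  have cm: "c j mod base i = c i" if "i \<le> j" for i j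
    using that
  proof (induction j rule: dec_induct)
    case (step j)
    have "base i dvd base j * a (Suc j)" using base_dvd[OF step(1)] by simp
    then have "(base j * a (Suc j) + c j) mod base i = c j mod base i"
      by (metis add_0 mod_0_imp_dvd dvd_imp_mod_0 mod_add_left_eq)
    then show ?case using step(3) by (simp add: cs)
  qed (simp add: cb)
  define w where "w k = I (int (c k)) origin" for k
  have w: "w k \<in> X" for k using I_closed origin by (simp add: w_def)
  have agw: "agree (level i) (I (t + int (c j)) origin) (I (t + int (c i)) origin)" if "i \<le> j" for i j t
  proof (rule period_cong[OF origin])
    have "int (c j) mod int (base i) = int (c i) mod int (base i)" using cm[OF that] cb by (simp flip: of_nat_mod)
    then show "(t + int (c j)) mod int (period (level i)) = (t + int (c i)) mod int (period (level i))"
      unfolding base_def by (rule mod_add_cong[OF refl])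
  qed
  \<comment> \<open>the diagonal is the limit of the points w k, which agree up to level k\<close>
  define y where "y i = (if i = 0 then undefined else w i i)" for i
  have yw: "y i = w j i" if "1 \<le> i" "i \<le> j" for i j
  proof -
    have "agree (level i) (w j) (w i)" using agw[OF that(2), of 0] by (simp add: w_def)
    then show ?thesis using that le_level[of i] by (simp add: agree_def y_def)
  qed
  have y: "y \<in> X"
  proof (rule path_spaceI)
    fix i :: nat assume i: "1 \<le> i"
    show "y i \<in> Edg B i" using i path(1)[OF w i] by (simp add: y_def)
    show "rng B (y i) = src B (y (Suc i))"
      using i yw[of i "Suc i"] yw[of "Suc i" "Suc i"] path(3)[OF w i, of "Suc i"] by (simp add: vertex_def)
  qed (simp add: y_def)
  have ph: "phase k y = c k" for k
  proof -
    obtain m where m: "\<forall>z\<in>X. agree m y z \<longrightarrow> (\<forall>t. agree (level k) (I t y) (I t z))"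
      using rows_local[OF y] by blast
    define j where "j = max m k"
    have "agree m y (w j)" using yw[of _ j] by (auto simp: agree_def j_def)
    then have near: "agree (level k) (I t y) (I t (w j))" for t using m w by blast
    have wj: "I t (w j) = I (t + int (c j)) origin" for t
      using I_add[OF origin] by (simp add: w_def)
    have "k \<le> j" by (simp add: j_def)
    then have "has_phase k y (int (c k))"
      unfolding has_phase_def using near[unfolded wj] agw agree_trans by blast
    then show ?thesis using phase_eqI[OF y] cb[of k] by (metis mod_less of_nat_eq_iff of_nat_mod)
  qed
  have "digits y = a"
  proof
    fix i
    show "digits y i = a i"
    proof (cases i)
      case 0
      then show ?thesis using a by (auto simp: digits_def PiE_def extensional_def)
    next
      case (Suc k)
      then show ?thesis using cb[of k] base_pos[of k] by (simp add: digits_def ph cs)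
    qed
  qed
  with y show ?thesis by blast
qed

theorem odometer: "odometer_system (path_topology B) T"
proof -
  have "homeomorphic_map (path_topology B) (odometer_topology base) digits"
  proof (rule continuous_imp_homeomorphic_map[OF _ compact_path_space])
    have "continuous_map (path_topology B) (discrete_topology {..<base i div base (i - 1)}) (\<lambda>y. digits y i)"
      if "i \<in> {1..}" for i
    proof (rule continuous_into_discrete)
      show "y \<in> X \<Longrightarrow> digits y i \<in> {..<base i div base (i - 1)}" for y
        using PiE_mem[OF digits_range that] .
      fix y assume "y \<in> X"
      then obtain m where "\<forall>z\<in>X. agree m y z \<longrightarrow> phase i y = phase i z" using phase_local by blast
      then have "\<forall>z\<in>X. agree m y z \<longrightarrow> digits y i = digits z i" by (simp add: digits_def)
      then show "\<exists>m. \<forall>z\<in>X. agree m y z \<longrightarrow> digits y i = digits z i" ..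
    qed
    moreover have "digits \<in> X \<rightarrow> extensional {1..}" by (auto simp: digits_def)
    ultimately show "continuous_map (path_topology B) (odometer_topology base) digits"
      unfolding odometer_topology_def by (auto simp: continuous_map_componentwise)
    show "Hausdorff_space (odometer_topology base)"
      by (simp add: odometer_topology_def Hausdorff_space_product_topology)
    show "digits ` topspace (path_topology B) = topspace (odometer_topology base)"
    proof -
      have "topspace (odometer_topology base) = (\<Pi>\<^sub>E i\<in>{1..}. {..<base i div base (i - 1)})"
        by (simp add: odometer_topology_def)
      moreover have "digits ` X = (\<Pi>\<^sub>E i\<in>{1..}. {..<base i div base (i - 1)})"
        using digits_range digits_surj by blast
      ultimately show ?thesis by simp
    qed
    show "inj_on digits (topspace (path_topology B))" using digits_inj by simp
  qed
  then show ?thesis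
    unfolding odometer_system_def conjugate_systems_def using odometer_base digits_T by auto
qed

end

theorem mainTheorem1:
  fixes B :: "('v, 'e) bratteli_data" and R :: "'e rel"
  assumes "properly_ordered B R"
    and "infinite (path_space B)"
    and "finite_rank B"
  shows "odometer_system (path_topology B) (vershik_map B R) \<or>
         expansive_system (path_topology B) (vershik_map B R)"
proof -
  interpret vershik B R by unfold_locales (rule assms)
  obtain L where L: "\<And>n. card (Vtx B n) \<le> L" using assms(3) by (auto simp: finite_rank_def)
  show ?thesis
  proof (cases "\<exists>i0. \<forall>i\<ge>i0. \<forall>x\<in>X. \<not> periodic (row i x)")
    case True
    then obtain i0 where "\<And>i x. i0 \<le> i \<Longrightarrow> x \<in> X \<Longrightarrow> \<not> periodic (row i x)" by blast
    then obtain i where "\<forall>x\<in>X. \<forall>y\<in>X. row i x = row i y \<longrightarrow> x = y"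
      using aperiodic_row_determines_point[OF L] by blast
    then show ?thesis using expansive_if_row_determines_point by blast
  next
    case False
    have "\<exists>p>0. \<forall>y\<in>X. agree n (I (int p) y) y" for n
    proof -
      obtain i x where ix: "n \<le> i" "x \<in> X" "periodic (row i x)" using False by blast
      then obtain p where "p > 0" "\<And>k. row i x (k + p) = row i x k" unfolding periodic_def by blast
      note * = ix(1,2) this
      have "agree n (I (k + p) x) (I k x)" for k
        using *(4)[of k] agree_mono[OF _ *(1)] by (simp add: row_def initial_eq_iff)
      then have "\<forall>y\<in>X. agree n (I p y) y" using period_transfer[OF *(2)] by blast
      with *(3) show ?thesis by (intro exI[of _ "nat p"]) auto
    qed
    then interpret periodic_vershik B R by unfold_locales (use assms(2) in auto)
    show ?thesis using odometer by blast
  qed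
qed

end
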